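(* Fix $\epsilon>0$ and an integer $k_0$, and let $J$ be a time interval. Suppose $M:\mathbf{R}^3\to\mathbf{R}$ satisfies $|M(x)|\lesssim e^{-c|x|}$ for some $c>0$, and $f,g,h$ are functions on $J\times\mathbf{R}^3$. Then $$\|I(M(x)gh)f\|_{L^1_{t,x}(J\times\mathbf{R}^3)}\lesssim|k_0|\,\|g\|_{L^2_{t,x}(J\times\mathbf{R}^3)}\|f\|_{l^\infty_{k_0}L^2_{t,x}(J\times\mathbf{R}^3)}\Big(2^{-k_0/2}\|h\|_{L^\infty_{t,x}(J\times\mathbf{R}^3)}+\||x|^{1/2}h\|_{L^\infty_{t,x}(J\times\mathbf{R}^3)}\Big).$$
   Context: Littlewood–Paley projections: let $\psi\in C_0^\infty(\mathbf{R}^3)$ be radial, decreasing, supported in $|\xi|\le2$, with $\psi=1$ on $|\xi|\le1$; $P_jf=\mathcal F^{-1}\big((\psi(\xi/2^j)-\psi(2\xi/2^j))\hat f(\xi)\big)$ for $j\in\mathbf{Z}$, $P_{\le j}=\sum_{l\le j}P_l$ (acting in $x$). With $N=2^{k_0}$, the operator $I$ is $I=P_{\le k_0}+\sum_{j>0}2^{-j(1/2-\epsilon)}P_{j+k_0}$. For $l\in\mathbf{Z}$, $B_l=\{x:|x|\le2^l\}$, and $\|f\|_{l^\infty_{k_0}L^2_{t,x}(J\times\mathbf{R}^3)}=\sup_{l\in\mathbf{Z},\,l\ge-k_0}2^{-l/2}\|f\|_{L^2_{t,x}(J\times B_l)}$. Implicit constants may depend on $\epsilon$ and on $M$ through $c$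 and its bound, but not on $k_0$, $J$, $f,g,h$.
   Formalization: Proved for 0<ε<1/2 and k_0≠0, with M,f,g,h Borel measurable: at k_0=0 the right side vanishes and the claim fails; for ε>1/2 the multiplier of I is unbounded and it fails; the degenerate endpoint ε=1/2, where I is the identity, is also left out. *)

theory Defs
  imports "HOL-Analysis.Analysis" "HOL-Probability.Essential_Supremum"
begin

text \<open>C-infinity for real functions on R^3: all iterated partial derivatives exist and are continuous.\<close>
definition smooth3 :: "(real^3 \<Rightarrow> real) \<Rightarrow> bool" where
  "smooth3 \<psi> \<longleftrightarrow> (\<exists>D. \<psi> \<in> D \<and>
     (\<forall>g\<in>D. (\<forall>x. g differentiable (at x)) \<and> continuous_on UNIV g \<and>
        (\<forall>i. (\<lambda>x. frechet_derivative g (at x) (axis i 1)) \<in> D)))"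

definition lp_bump :: "(real^3 \<Rightarrow> real) \<Rightarrow> bool" where
  "lp_bump \<psi> \<longleftrightarrow> smooth3 \<psi>
     \<and> (\<forall>\<xi> \<eta>. norm \<xi> = norm \<eta> \<longrightarrow> \<psi> \<xi> = \<psi> \<eta>)
     \<and> (\<forall>\<xi> \<eta>. norm \<xi> \<le> norm \<eta> \<longrightarrow> \<psi> \<eta> \<le> \<psi> \<xi>)
     \<and> (\<forall>\<xi>. norm \<xi> > 2 \<longrightarrow> \<psi> \<xi> = 0)
     \<and> (\<forall>\<xi>. norm \<xi> \<le> 1 \<longrightarrow> \<psi> \<xi> = 1)"

definition ft3 :: "(real^3 \<Rightarrow> complex) \<Rightarrow> real^3 \<Rightarrow> complex" where
  "ft3 F \<xi> = (\<integral>x. F x * cis (- (x \<bullet> \<xi>)) \<partial>lborel)"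

definition ift3 :: "(real^3 \<Rightarrow> complex) \<Rightarrow> real^3 \<Rightarrow> complex" where
  "ift3 G x = complex_of_real (1 / (2 * pi) ^ 3) * (\<integral>\<xi>. G \<xi> * cis (x \<bullet> \<xi>) \<partial>lborel)"

definition LP :: "(real^3 \<Rightarrow> real) \<Rightarrow> int \<Rightarrow> (real^3 \<Rightarrow> complex) \<Rightarrow> real^3 \<Rightarrow> complex" where
  "LP \<psi> j F = ift3 (\<lambda>\<xi>. complex_of_real
       (\<psi> ((1 / 2 powr real_of_int j) *\<^sub>R \<xi>) - \<psi> ((2 / 2 powr real_of_int j) *\<^sub>R \<xi>)) * ft3 F \<xi>)"

definition LP_le :: "(real^3 \<Rightarrow> real) \<Rightarrow> int \<Rightarrow> (real^3 \<Rightarrow> complex) \<Rightarrow> real^3 \<Rightarrow> complex" where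
  "LP_le \<psi> j F x = (\<Sum>n. LP \<psi> (j - int n) F x)"

text \<open>The I-operator with N = 2^k0.\<close>
definition Iop :: "(real^3 \<Rightarrow> real) \<Rightarrow> real \<Rightarrow> int \<Rightarrow> (real^3 \<Rightarrow> complex) \<Rightarrow> real^3 \<Rightarrow> complex" where
  "Iop \<psi> \<epsilon> k0 F x = LP_le \<psi> k0 F x
     + (\<Sum>n. complex_of_real (2 powr (- real (Suc n) * (1/2 - \<epsilon>))) * LP \<psi> (int (Suc n) + k0) F x)"

definition esqrt :: "ennreal \<Rightarrow> ennreal" where
  "esqrt a = (if a = \<infinity> then \<infinity> else ennreal (sqrt (enn2real a)))"

definition L1norm :: "real set \<Rightarrow> (real \<Rightarrow> real^3 \<Rightarrow> complex) \<Rightarrow> ennreal" where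
  "L1norm J u = (\<integral>\<^sup>+ p. ennreal (norm (u (fst p) (snd p))) * indicator J (fst p) \<partial>lborel)"

definition L2norm_on :: "real set \<Rightarrow> (real^3) set \<Rightarrow> (real \<Rightarrow> real^3 \<Rightarrow> complex) \<Rightarrow> ennreal" where
  "L2norm_on J B u = esqrt (\<integral>\<^sup>+ p. ennreal ((norm (u (fst p) (snd p)))\<^sup>2)
        * indicator J (fst p) * indicator B (snd p) \<partial>lborel)"

definition Linfnorm :: "real set \<Rightarrow> (real \<Rightarrow> real^3 \<Rightarrow> complex) \<Rightarrow> ennreal" where
  "Linfnorm J u = esssup lborel (\<lambda>p. ennreal (norm (u (fst p) (snd p))) * indicator J (fst p))"

definition linfL2norm :: "int \<Rightarrow> real set \<Rightarrow> (real \<Rightarrow> real^3 \<Rightarrow> complex) \<Rightarrow> ennreal" where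
  "linfL2norm k0 J u = (SUP l\<in>{-k0..}. ennreal (2 powr (- real_of_int l / 2))
        * L2norm_on J (cball 0 (2 powr real_of_int l)) u)"

end

theory Submission
  imports Defs
begin

text \<open>
  Write \<open>K\<^sub>j\<close> for the inverse Fourier transform of \<open>\<psi>(\<xi>/2\<^sup>j)\<close>. Each \<open>P\<^sub>j\<close> is a difference of convolutions with
  \<open>K\<^sub>j\<close> and \<open>K\<^sub>j\<^sub>-\<^sub>1\<close>; the sum defining \<open>P\<^sub>\<le>\<^sub>k\<close> must be telescoped to \<open>K\<^sub>k\<close> before taking absolute values, because
  the absolute values of the kernels of \<open>P\<^sub>l\<close>, \<open>l \<le> k\<close>, do not have an integrable sum. Hence \<open>|I F| \<le> K * |F|\<close>
  with \<open>K\<close> a geometric combination of the \<open>|K\<^sub>j|\<close>, \<open>j \<ge> k\<close>, and scaling together with the rapid decay of \<open>K\<^sub>0\<close> bounds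
  \<open>\<integral> K(z) (1 + (2\<^sup>k|z|)\<^sup>1\<^sup>/\<^sup>2) dz\<close> uniformly in \<open>k\<close>. (If \<open>F\<close> is not integrable, \<open>ft3 F\<close> vanishes identically and so
  does \<open>I F\<close>.)

  After substituting \<open>x = y + z\<close> it remains to bound, for fixed \<open>z\<close>, the integral of \<open>|M g h|(t,y) |f(t,y+z)|\<close> by
  \<open>(1 + (2\<^sup>k|z|)\<^sup>1\<^sup>/\<^sup>2)\<close> times the right-hand side. On the shell where \<open>|y|\<close> is about \<open>2\<^sup>l\<close>, \<open>l \<ge> -k\<close>, Cauchy-Schwarz
  costs \<open>(2\<^sup>l + |z|)\<^sup>1\<^sup>/\<^sup>2\<close> from \<open>f\<close> on the ball of radius \<open>2\<^sup>l + |z|\<close>, while \<open>h\<close> gains \<open>2\<^sup>-\<^sup>l\<^sup>/\<^sup>2\<close>. Every shell thus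
  contributes the same amount, times \<open>exp(-c|y|)\<close> from \<open>M\<close>; the shells inside the unit ball, where \<open>M\<close> gives no
  gain, are responsible for the factor \<open>|k|\<close>.
\<close>

section \<open>Decay of Fourier transforms of bump functions\<close>

lemma nn_integral_lborel_affine:
  fixes f :: "'a::euclidean_space \<Rightarrow> ennreal"
  assumes [measurable]: "f \<in> borel_measurable borel" and "c \<noteq> 0"
  shows "(\<integral>\<^sup>+x. f x \<partial>lborel) = ennreal (\<bar>c\<bar> ^ DIM('a)) * (\<integral>\<^sup>+x. f (t + c *\<^sub>R x) \<partial>lborel)"
  by (subst lborel_affine[OF \<open>c \<noteq> 0\<close>, of t])
     (simp add: nn_integral_density nn_integral_distr nn_integral_cmult)

lemma integral_lborel_affine:
  fixes f :: "'a::euclidean_space \<Rightarrow> 'b::{banach, second_countable_topology}"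
  assumes [measurable]: "f \<in> borel_measurable borel" and "c \<noteq> 0"
  shows "(\<integral>x. f x \<partial>lborel) = \<bar>c\<bar> ^ DIM('a) *\<^sub>R (\<integral>x. f (t + c *\<^sub>R x) \<partial>lborel)"
  by (subst lborel_affine[OF \<open>c \<noteq> 0\<close>, of t])
     (simp add: integral_density integral_distr)

lemma integrable_compact_support:
  fixes f :: "'a::euclidean_space \<Rightarrow> 'b::{banach, second_countable_topology}"
  assumes "continuous_on UNIV f" "\<And>x. norm x > R \<Longrightarrow> f x = 0"
  shows "integrable lborel f"
proof -
  have "integrable lborel (\<lambda>x. indicator (cball 0 R) x *\<^sub>R f x)"
    using assms by (intro borel_integrable_compact continuous_on_subset[OF assms(1)]) auto
  also have "(\<lambda>x. indicator (cball 0 R) x *\<^sub>R f x) = f"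
    using assms(2) by (auto simp: indicator_def fun_eq_iff)
  finally show ?thesis .
qed

lemma bounded_compact_support:
  fixes f :: "'a::euclidean_space \<Rightarrow> 'b::real_normed_vector"
  assumes "continuous_on UNIV f" "\<And>x. norm x > R \<Longrightarrow> f x = 0"
  obtains B where "B > 0" "\<And>x. norm (f x) \<le> B"
proof -
  have "compact (f ` cball 0 R)"
    using assms by (intro compact_continuous_image continuous_on_subset[OF assms(1)]) auto
  then obtain B where "B > 0" "\<forall>y\<in>f ` cball 0 R. norm y \<le> B"
    using compact_imp_bounded bounded_pos by metis
  then have "norm (f x) \<le> B" for x
    using assms(2)[of x] by (cases "norm x \<le> R") auto
  with \<open>B > 0\<close> show ?thesis by (rule that)
qed

section \<open>Fourier integrals of derivatives of compactly supported functions\<close>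

lemma cis_measurable [measurable]: "cis \<in> borel_measurable borel"
  by (intro borel_measurable_continuous_onI continuous_intros)

text \<open>Integration by parts through translation invariance: the Fourier integral of a
  difference quotient of \<open>g\<close> along \<open>b\<close> equals, after a shift of the
  variable, \<open>(cis (- (h n * w)) - 1) / h n\<close> times that of \<open>g\<close>. Dominated
  convergence on one side and the derivative of the exponential at 0 on the other give the
  limit.\<close>

lemma integral_directional_derivative_cis:
  fixes g :: "'a::euclidean_space \<Rightarrow> real"
  assumes diff: "\<And>x. g differentiable (at x)"
    and cont: "continuous_on UNIV (\<lambda>x. frechet_derivative g (at x) b)"
    and supp: "\<And>x. norm x > R \<Longrightarrow> g x = 0"
  shows "(\<integral>\<xi>. of_real (frechet_derivative g (at \<xi>) b) * cis (z \<bullet> \<xi>) \<partial>lborel)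
     = - \<i> * of_real (z \<bullet> b) * (\<integral>\<xi>. of_real (g \<xi>) * cis (z \<bullet> \<xi>) \<partial>lborel)"
proof -
  define D where "D x = frechet_derivative g (at x) b" for x
  define h where "h n = inverse (real (Suc n))" for n
  define w where "w = z \<bullet> b"
  define T where "T = (\<integral>\<xi>. of_real (g \<xi>) * cis (z \<bullet> \<xi>) \<partial>lborel)"
  have hpos: "0 < h n" and hle: "h n \<le> 1" for n by (auto simp: h_def field_simps)
  have hlim: "h \<longlonglongrightarrow> 0" unfolding h_def by (rule LIMSEQ_inverse_real_of_nat)
  have contg: "continuous_on UNIV g"
    using diff by (simp add: continuous_at_imp_continuous_on differentiable_imp_continuous_within)
  have contD: "continuous_on UNIV D" using cont by (simp add: D_def[abs_def])
  note [measurable] = borel_measurable_continuous_onI[OF contg] borel_measurable_continuous_onI[OF contD]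
  have gd: "(g has_derivative frechet_derivative g (at x)) (at x)" for x
    using diff frechet_derivative_works by blast
  have suppD: "D x = 0" if "norm x > R" for x
  proof -
    have z: "(g has_derivative (\<lambda>_. 0)) (at x)"
      by (rule has_derivative_transform_within_open[of "\<lambda>_. 0" _ _ _ "- cball 0 R"])
         (use that supp in auto)
    then show ?thesis
      using has_derivative_unique[OF gd z] by (simp add: D_def)
  qed
  obtain B where B: "B > 0" "\<And>x. norm (D x) \<le> B"
    using bounded_compact_support[OF contD suppD] by blast
  have ray: "((\<lambda>r. g (x + r *\<^sub>R b)) has_real_derivative D (x + r *\<^sub>R b)) (at r)" for x r
  proof -
    have "((\<lambda>r. g (x + r *\<^sub>R b)) has_derivative (\<lambda>s. frechet_derivative g (at (x + r *\<^sub>R b)) (s *\<^sub>R b))) (at r)"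
      by (rule has_derivative_compose[of "\<lambda>r. x + r *\<^sub>R b", OF _ gd]) (auto intro!: derivative_eq_intros)
    moreover have "frechet_derivative g (at (x + r *\<^sub>R b)) (s *\<^sub>R b) = D (x + r *\<^sub>R b) * s" for s
      using linear_frechet_derivative[OF diff] by (simp add: D_def linear_scale)
    ultimately show ?thesis by (simp add: has_field_derivative_def)
  qed
  define s where "s n x = (g (x + h n *\<^sub>R b) - g x) / h n" for n x
  have [measurable]: "s n \<in> borel_measurable borel" for n
    unfolding s_def[abs_def] by measurable
  \<comment> \<open>The mean value theorem bounds the quotients by the supremum of the directional
    derivative, and \<open>h n \<le> 1\<close> keeps all their supports in one ball. This gives the
    dominating function.\<close>
  have sbound: "\<bar>s n x\<bar> \<le> B * indicator (cball 0 (R + norm b)) x" for n x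
  proof (cases "norm x \<le> R + norm b")
    case True
    have "\<exists>\<xi>>0. \<xi> < h n \<and> g (x + h n *\<^sub>R b) - g (x + 0 *\<^sub>R b) = (h n - 0) * D (x + \<xi> *\<^sub>R b)"
      by (rule MVT2[OF hpos]) (use ray in auto)
    then obtain \<xi> where "g (x + h n *\<^sub>R b) - g x = h n * D (x + \<xi> *\<^sub>R b)" by auto
    then have "s n x = D (x + \<xi> *\<^sub>R b)" using hpos[of n] by (simp add: s_def)
    then show ?thesis using B(2)[of "x + \<xi> *\<^sub>R b"] True by (simp add: indicator_def)
  next
    case False
    have "norm x \<le> norm (x + h n *\<^sub>R b) + norm (h n *\<^sub>R b)"
      using norm_triangle_ineq4[of "x + h n *\<^sub>R b" "h n *\<^sub>R b"] by simp
    moreover have "norm (h n *\<^sub>R b) \<le> norm b"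
      using hle[of n] hpos[of n] by (simp add: mult_left_le_one_le)
    ultimately have "norm (x + h n *\<^sub>R b) > R" "norm x > R" 
      using False norm_ge_zero[of b] by linarith+
    then show ?thesis by (simp add: s_def supp indicator_def B(1) less_imp_le)
  qed
  have slim: "(\<lambda>n. s n x) \<longlonglongrightarrow> D x" for x
  proof -
    have "((\<lambda>r. (g (x + (0 + r) *\<^sub>R b) - g (x + 0 *\<^sub>R b)) / r) \<longlongrightarrow> D (x + 0 *\<^sub>R b)) (at 0)"
      using ray[of x 0] unfolding DERIV_def by simp
    from filterlim_compose[OF this, of h sequentially] show ?thesis
      using hpos hlim by (auto simp: s_def filterlim_at less_imp_neq[THEN not_sym])
  qed
  have int_g: "integrable lborel (\<lambda>\<xi>. of_real (g \<xi>) * cis (z \<bullet> \<xi>) :: complex)"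
    by (rule integrable_compact_support[of _ R]) (auto intro!: continuous_intros contg simp: supp)
  have shift: "(\<integral>\<xi>. of_real (g (\<xi> + h n *\<^sub>R b)) * cis (z \<bullet> \<xi>) \<partial>lborel) = cis (- (h n * w)) * T"
    and int_shift: "integrable lborel (\<lambda>\<xi>. of_real (g (\<xi> + h n *\<^sub>R b)) * cis (z \<bullet> \<xi>) :: complex)" for n
  proof -
    have eq: "of_real (g (\<xi> + h n *\<^sub>R b)) * cis (z \<bullet> \<xi>)
        = cis (- (h n * w)) * (of_real (g (h n *\<^sub>R b + 1 *\<^sub>R \<xi>)) * cis (z \<bullet> (h n *\<^sub>R b + 1 *\<^sub>R \<xi>)))" for \<xi>
      by (simp add: w_def inner_add_right inner_commute cis_mult add.commute flip: mult.assoc)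
    have T: "T = (\<integral>\<xi>. of_real (g (h n *\<^sub>R b + 1 *\<^sub>R \<xi>)) * cis (z \<bullet> (h n *\<^sub>R b + 1 *\<^sub>R \<xi>)) \<partial>lborel)"
      unfolding T_def by (subst integral_lborel_affine[where c = 1 and t = "h n *\<^sub>R b"]) auto
    show "(\<integral>\<xi>. of_real (g (\<xi> + h n *\<^sub>R b)) * cis (z \<bullet> \<xi>) \<partial>lborel) = cis (- (h n * w)) * T"
      unfolding eq T by simp
    show "integrable lborel (\<lambda>\<xi>. of_real (g (\<xi> + h n *\<^sub>R b)) * cis (z \<bullet> \<xi>) :: complex)"
    proof (rule integrable_compact_support[of _ "R + norm (h n *\<^sub>R b)"])
      show "continuous_on UNIV (\<lambda>\<xi>. of_real (g (\<xi> + h n *\<^sub>R b)) * cis (z \<bullet> \<xi>) :: complex)"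
        by (intro continuous_intros continuous_on_compose2[OF contg]) auto
      fix x :: 'a assume "R + norm (h n *\<^sub>R b) < norm x"
      moreover have "norm x \<le> norm (x + h n *\<^sub>R b) + norm (h n *\<^sub>R b)"
        using norm_triangle_ineq4[of "x + h n *\<^sub>R b" "h n *\<^sub>R b"] by simp
      ultimately have "norm (x + h n *\<^sub>R b) > R" by linarith
      then show "complex_of_real (g (x + h n *\<^sub>R b)) * cis (z \<bullet> x) = 0" by (simp add: supp)
    qed
  qed
  have lim1: "(\<lambda>n. \<integral>\<xi>. of_real (s n \<xi>) * cis (z \<bullet> \<xi>) \<partial>lborel)
      \<longlonglongrightarrow> (\<integral>\<xi>. of_real (D \<xi>) * cis (z \<bullet> \<xi>) \<partial>lborel)"
  proof (rule integral_dominated_convergence[where w = "\<lambda>x. B * indicator (cball 0 (R + norm b)) x"])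
    show "integrable lborel (\<lambda>x::'a. B * indicat_real (cball 0 (R + norm b)) x)"
      by (intro integrable_mult_right) (auto simp: integrable_indicator_iff emeasure_bounded_finite[unfolded infinity_ennreal_def])
  qed (use sbound in \<open>auto intro!: tendsto_intros slim always_eventually simp: norm_mult\<close>)
  have val: "(\<integral>\<xi>. of_real (s n \<xi>) * cis (z \<bullet> \<xi>) \<partial>lborel) = (cis (- (h n * w)) - 1) / of_real (h n) * T" for n
  proof -
    have "(\<integral>\<xi>. of_real (s n \<xi>) * cis (z \<bullet> \<xi>) \<partial>lborel)
       = (\<integral>\<xi>. inverse (of_real (h n)) * (of_real (g (\<xi> + h n *\<^sub>R b)) * cis (z \<bullet> \<xi>) - of_real (g \<xi>) * cis (z \<bullet> \<xi>)) \<partial>lborel)"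
      by (simp add: s_def field_simps)
    also have "\<dots> = inverse (of_real (h n)) * (cis (- (h n * w)) * T - T)"
      using int_shift[of n] int_g by (simp add: shift flip: T_def)
    finally show ?thesis by (simp add: field_simps)
  qed
  have lim2: "(\<lambda>n. (cis (- (h n * w)) - 1) / of_real (h n) * T) \<longlonglongrightarrow> - \<i> * of_real w * T"
  proof -
    have "((\<lambda>x. exp (- \<i> * of_real w * x)) has_field_derivative - \<i> * of_real w) (at 0)"
      by (auto intro!: derivative_eq_intros)
    then have "((\<lambda>x. (exp (- \<i> * of_real w * x) - 1) / x) \<longlongrightarrow> - \<i> * of_real w) (at 0)"
      by (simp add: DERIV_def)
    moreover have "filterlim (\<lambda>n. complex_of_real (h n)) (at 0) sequentially"
      using hpos tendsto_of_real[OF hlim, where 'a = complex]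
      by (auto simp: filterlim_at less_imp_neq[THEN not_sym])
    ultimately have "(\<lambda>n. (exp (- \<i> * of_real w * of_real (h n)) - 1) / of_real (h n)) \<longlonglongrightarrow> - \<i> * of_real w"
      by (rule filterlim_compose)
    moreover have "exp (- \<i> * of_real w * of_real (h n)) = cis (- (h n * w))" for n
      by (simp add: cis_conv_exp mult_ac)
    ultimately show ?thesis by (intro tendsto_mult_right) simp
  qed
  show ?thesis
    using LIMSEQ_unique[OF lim1[unfolded val] lim2] by (simp add: D_def w_def T_def)
qed

text \<open>A class \<open>D\<close> witnessing smoothness of \<open>g\<close> is closed under
  partial derivatives, so the same \<open>D\<close> witnesses smoothness of each partial.\<close>

lemma smooth3_differentiable: "smooth3 g \<Longrightarrow> g differentiable (at x)"
  and smooth3_continuous: "smooth3 g \<Longrightarrow> continuous_on UNIV g"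
  and smooth3_partial: "smooth3 g \<Longrightarrow> smooth3 (\<lambda>x. frechet_derivative g (at x) (axis i 1))"
  unfolding smooth3_def by blast+

text \<open>The witness is the \<open>k\<close>-fold partial derivative in direction
  \<open>i\<close>: each differentiation keeps smoothness and support and contributes one factor
  \<open>- \<i> * z $ i\<close>.\<close>

lemma smooth3_iterated_partial:
  fixes g :: "real^3 \<Rightarrow> real"
  assumes "smooth3 g" "\<And>x. norm x > R \<Longrightarrow> g x = 0"
  shows "\<exists>G. smooth3 G \<and> (\<forall>x. norm x > R \<longrightarrow> G x = 0) \<and>
    (\<forall>z. (\<integral>\<xi>. of_real (G \<xi>) * cis (z \<bullet> \<xi>) \<partial>lborel)
        = (- \<i> * of_real (z $ i)) ^ k * (\<integral>\<xi>. of_real (g \<xi>) * cis (z \<bullet> \<xi>) \<partial>lborel))"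
proof (induction k)
  case 0
  show ?case using assms by auto
next
  case (Suc k)
  then obtain G where G: "smooth3 G" "\<And>x. norm x > R \<Longrightarrow> G x = 0"
    "\<And>z. (\<integral>\<xi>. of_real (G \<xi>) * cis (z \<bullet> \<xi>) \<partial>lborel)
        = (- \<i> * of_real (z $ i)) ^ k * (\<integral>\<xi>. of_real (g \<xi>) * cis (z \<bullet> \<xi>) \<partial>lborel)"
    by blast
  let ?D = "\<lambda>x. frechet_derivative G (at x) (axis i 1)"
  have "?D x = 0" if "norm x > R" for x
  proof -
    have z: "(G has_derivative (\<lambda>_. 0)) (at x)"
      by (rule has_derivative_transform_within_open[of "\<lambda>_. 0" _ _ _ "- cball 0 R"])
         (use that G in auto)
    show ?thesis using fun_cong[OF frechet_derivative_at[OF z], of "axis i 1"] by simp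
  qed
  moreover have "(\<integral>\<xi>. of_real (?D \<xi>) * cis (z \<bullet> \<xi>) \<partial>lborel)
        = (- \<i> * of_real (z $ i)) ^ Suc k * (\<integral>\<xi>. of_real (g \<xi>) * cis (z \<bullet> \<xi>) \<partial>lborel)" for z
    using integral_directional_derivative_cis[of G "axis i 1" R z] G
      smooth3_continuous[OF smooth3_partial[OF G(1)]] smooth3_differentiable[OF G(1)]
    by (simp add: inner_axis mult.assoc)
  ultimately show ?case
    using smooth3_partial[OF G(1)] by (intro exI[of _ ?D]) simp
qed

text \<open>Differentiating \<open>k\<close> times in coordinate \<open>i\<close> multiplies the
  Fourier integral by a power of \<open>z $ i\<close>, and the result is bounded by the L1 norm of
  the derivative. As every coordinate is available, the largest one can be used to control
  \<open>norm z\<close>.\<close>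

lemma smooth3_ft_decay:
  fixes g :: "real^3 \<Rightarrow> real"
  assumes "smooth3 g" "\<And>x. norm x > R \<Longrightarrow> g x = 0"
  shows "\<exists>C. \<forall>z. norm z ^ k * norm (\<integral>\<xi>. of_real (g \<xi>) * cis (z \<bullet> \<xi>) \<partial>lborel) \<le> C"
proof -
  define T where "T z = (\<integral>\<xi>. complex_of_real (g \<xi>) * cis (z \<bullet> \<xi>) \<partial>lborel)" for z
  have "\<forall>i. \<exists>G. smooth3 G \<and> (\<forall>x. norm x > R \<longrightarrow> G x = 0) \<and>
    (\<forall>z. (\<integral>\<xi>. of_real (G \<xi>) * cis (z \<bullet> \<xi>) \<partial>lborel) = (- \<i> * of_real (z $ i)) ^ k * T z)"
    unfolding T_def using smooth3_iterated_partial[OF assms] by blast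
  from choice[OF this] obtain G where G: "\<And>i. smooth3 (G i)" "\<And>i x. norm x > R \<Longrightarrow> G i x = 0"
    "\<And>i z. (\<integral>\<xi>. of_real (G i \<xi>) * cis (z \<bullet> \<xi>) \<partial>lborel) = (- \<i> * of_real (z $ i)) ^ k * T z"
    by blast
  define C where "C = (\<Sum>i\<in>UNIV. \<integral>\<xi>. \<bar>G i \<xi>\<bar> \<partial>lborel)"
  have coord: "\<bar>z $ i\<bar> ^ k * norm (T z) \<le> C" for z i
  proof -
    have "\<bar>z $ i\<bar> ^ k * norm (T z) = norm (\<integral>\<xi>. of_real (G i \<xi>) * cis (z \<bullet> \<xi>) \<partial>lborel)"
      by (simp add: G norm_mult norm_power)
    also have "\<dots> \<le> (\<integral>\<xi>. norm (of_real (G i \<xi>) * cis (z \<bullet> \<xi>)) \<partial>lborel)"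
      by (rule integral_norm_bound)
    also have "\<dots> = (\<integral>\<xi>. \<bar>G i \<xi>\<bar> \<partial>lborel)" by (simp add: norm_mult)
    also have "\<dots> \<le> C"
      unfolding C_def by (intro member_le_sum) auto
    finally show ?thesis .
  qed
  have "norm z ^ k * norm (T z) \<le> 3 ^ k * C" for z
  proof -
    \<comment> \<open>In three dimensions \<open>norm z\<close> is at most three times its largest
      coordinate modulus, hence the factor \<open>3 ^ k\<close>.\<close>
    have "Max (range (\<lambda>i. \<bar>z $ i\<bar>)) \<in> range (\<lambda>i. \<bar>z $ i\<bar>)" by (rule Max_in) auto
    then obtain i where "Max (range (\<lambda>i. \<bar>z $ i\<bar>)) = \<bar>z $ i\<bar>" by (rule rangeE)
    then have i: "\<bar>z $ j\<bar> \<le> \<bar>z $ i\<bar>" for j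
      using Max_ge[of "range (\<lambda>i. \<bar>z $ i\<bar>)" "\<bar>z $ j\<bar>"] by simp
    have "norm z \<le> (\<Sum>j\<in>UNIV. \<bar>z $ j\<bar>)" by (rule norm_le_l1_cart)
    also have "\<dots> \<le> 3 * \<bar>z $ i\<bar>" using sum_bounded_above[of UNIV "\<lambda>j. \<bar>z $ j\<bar>" "\<bar>z $ i\<bar>"] i by simp
    finally have "norm z ^ k * norm (T z) \<le> (3 * \<bar>z $ i\<bar>) ^ k * norm (T z)"
      by (intro mult_right_mono power_mono) auto
    also have "\<dots> = 3 ^ k * (\<bar>z $ i\<bar> ^ k * norm (T z))" by (simp add: power_mult_distrib)
    also have "\<dots> \<le> 3 ^ k * C" using coord by (intro mult_left_mono) auto
    finally show ?thesis .
  qed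
  then show ?thesis unfolding T_def by blast
qed

section \<open>Cubes and weighted integrals of decaying functions\<close>

lemma ennreal_le_suminf:
  fixes u :: "nat \<Rightarrow> ennreal"
  shows "u n \<le> (\<Sum>n. u n)"
  using sum_le_suminf[OF summableI, of "{n}" u] by simp

text \<open>Cubes stand in for balls in the dyadic sum below: their volume is an explicit product,
  and upper bounds are all that is wanted.\<close>

lemma emeasure_lborel_cube:
  assumes "r \<ge> 0"
  shows "emeasure lborel (cbox (- (r *\<^sub>R One)) (r *\<^sub>R (One :: 'a::euclidean_space))) = ennreal ((2 * r) ^ DIM('a))"
proof -
  have "(\<Prod>b\<in>(Basis :: 'a set). (r *\<^sub>R One - - (r *\<^sub>R One)) \<bullet> b) = (\<Prod>b\<in>(Basis :: 'a set). 2 * r)"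
    by (rule prod.cong[OF refl]) (auto simp: inner_simps)
  then show ?thesis
    using assms by (subst emeasure_lborel_cbox) auto
qed

lemma mem_cube:
  assumes "norm z \<le> r"
  shows "z \<in> cbox (- (r *\<^sub>R One)) (r *\<^sub>R (One :: 'a::euclidean_space))"
  unfolding mem_box
proof
  fix b :: 'a assume b: "b \<in> Basis"
  then show "- (r *\<^sub>R One) \<bullet> b \<le> z \<bullet> b \<and> z \<bullet> b \<le> r *\<^sub>R One \<bullet> b"
    using Basis_le_norm[OF b, of z] assms by (simp add: inner_simps abs_le_iff)
qed

text \<open>The shell where \<open>|z|\<close> is about \<open>2\<^sup>n\<close> contributes volume times weight times decay, about \<open>2\<^sup>3\<^sup>n 2\<^sup>n\<^sup>/\<^sup>2 2\<^sup>-\<^sup>4\<^sup>n\<close>.\<close>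

lemma nn_integral_weighted_finite:
  fixes F :: "real^3 \<Rightarrow> real"
  assumes nn: "\<And>z. F z \<ge> 0" and b0: "\<And>z. F z \<le> B" and b4: "\<And>z. norm z ^ 4 * F z \<le> B"
  shows "(\<integral>\<^sup>+z. ennreal (F z * (1 + sqrt (norm z))) \<partial>lborel) < \<infinity>"
proof -
  have "B \<ge> 0" using nn[of 0] b0[of 0] by linarith
  \<comment> \<open>The ratio of consecutive shell contributions, since 3 + 1/2 - 4 = -1/2.\<close>
  define r where "r = sqrt (1/2)"
  have pow8: "((2::real) ^ n) ^ k = (2 ^ k) ^ n" for n k
    by (simp only: power_mult[symmetric] mult.commute)
  have r: "0 < r" "r < 1" by (auto simp: r_def)
  \<comment> \<open>Here \<open>r ^ n / 8 ^ n\<close> is decay times weight, 2^(-4n) 2^(n/2). Of the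
    constant 32, the factor 16 is lost in the fourth power because only
    \<open>norm z > 2 ^ (n - 1)\<close> is known, and 2 comes from
    \<open>1 + sqrt s \<le> 2 * sqrt s\<close> for \<open>s \<ge> 1\<close>.\<close>
  define a :: "nat \<Rightarrow> real" where "a n = 32 * B * (r ^ n / 8 ^ n)" for n
  have a_nn: "a n \<ge> 0" for n using \<open>B \<ge> 0\<close> r by (simp add: a_def)
  have ptw: "\<exists>n. norm z \<le> 2 ^ n \<and> F z * (1 + sqrt (norm z)) \<le> a n" for z
  proof (cases "norm z \<le> 1")
    case True
    then have "F z * (1 + sqrt (norm z)) \<le> B * 2" using b0 nn \<open>B \<ge> 0\<close> by (intro mult_mono) auto
    with True \<open>B \<ge> 0\<close> show ?thesis by (intro exI[of _ 0]) (simp add: a_def)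
  next
    case False
    define n where "n = (LEAST n. norm z \<le> 2 ^ n)"
    have ex: "\<exists>n. norm z \<le> 2 ^ n" using real_arch_pow[of 2 "norm z"] less_imp_le by auto
    have n: "norm z \<le> 2 ^ n" unfolding n_def by (rule LeastI_ex[OF ex])
    with False obtain m where m: "n = Suc m" by (cases n) auto
    have lo: "norm z > 2 ^ m" using not_less_Least[of m "\<lambda>n. norm z \<le> 2 ^ n", folded n_def] m by simp
    have "(1 + sqrt (norm z)) \<le> 2 * sqrt (norm z)" using False by simp
    also have "\<dots> \<le> 2 * sqrt (2 ^ n)" using n by simp
    finally have s: "1 + sqrt (norm z) \<le> 2 * sqrt 2 ^ n" by (simp add: real_sqrt_power)
    have "(2 ^ m) ^ 4 * F z \<le> B"
      using b4[of z] mult_right_mono[OF power_mono[of "2 ^ m" "norm z" 4] nn[of z]] lo by simp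
    then have "16 ^ n * F z \<le> 16 * B"
      using pow8[of m 4] by (simp add: m)
    then have "F z \<le> 16 * B / 16 ^ n" by (simp add: field_simps)
    then have "F z * (1 + sqrt (norm z)) \<le> (16 * B / 16 ^ n) * (2 * sqrt 2 ^ n)"
      using s nn \<open>B \<ge> 0\<close> by (intro mult_mono) auto
    also have "\<dots> = 32 * B * (sqrt 2 / 16) ^ n" by (simp add: power_divide)
    also have "sqrt 2 / 16 = r / 8" by (simp add: r_def real_sqrt_divide field_simps)
    also have "32 * B * (r / 8) ^ n = a n" by (simp add: a_def power_divide)
    finally show ?thesis using n by blast
  qed
  \<comment> \<open>The cubes are nested, not disjoint; one good index per point suffices because
    all terms are nonnegative.\<close>
  have "ennreal (F z * (1 + sqrt (norm z))) \<le> (\<Sum>n. ennreal (a n) * indicator (cbox (- (2 ^ n *\<^sub>R One)) (2 ^ n *\<^sub>R One)) z)" for z :: "real^3"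
  proof -
    obtain n where n: "norm z \<le> 2 ^ n" "F z * (1 + sqrt (norm z)) \<le> a n" using ptw by blast
    have "z \<in> cbox (- (2 ^ n *\<^sub>R One)) (2 ^ n *\<^sub>R One)"
      using n(1) by (rule mem_cube)
    then have "ennreal (F z * (1 + sqrt (norm z))) \<le> ennreal (a n) * indicator (cbox (- (2 ^ n *\<^sub>R One)) (2 ^ n *\<^sub>R One)) z"
      using n by (simp add: ennreal_leI)
    also have "\<dots> \<le> (\<Sum>n. ennreal (a n) * indicator (cbox (- (2 ^ n *\<^sub>R One)) (2 ^ n *\<^sub>R One)) z)"
      by (rule ennreal_le_suminf)
    finally show ?thesis .
  qed
  then have "(\<integral>\<^sup>+z. ennreal (F z * (1 + sqrt (norm z))) \<partial>lborel)
     \<le> (\<integral>\<^sup>+z. (\<Sum>n. ennreal (a n) * indicator (cbox (- (2 ^ n *\<^sub>R One)) (2 ^ n *\<^sub>R (One :: real^3))) z) \<partial>lborel)"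
    by (intro nn_integral_mono) 
  also have "\<dots> = (\<Sum>n. \<integral>\<^sup>+z. ennreal (a n) * indicator (cbox (- (2 ^ n *\<^sub>R One)) (2 ^ n *\<^sub>R (One :: real^3))) z \<partial>lborel)"
    by (rule nn_integral_suminf) auto
  also have "\<dots> = (\<Sum>n. ennreal (256 * B * r ^ n))"
  proof (rule suminf_cong)
    fix n
    have "emeasure lborel (cbox (- (2 ^ n *\<^sub>R One)) (2 ^ n *\<^sub>R (One :: real^3))) = ennreal ((2 * 2 ^ n) ^ 3)"
      by (subst emeasure_lborel_cube) auto
    also have "(2 * 2 ^ n) ^ 3 = (8 * 8 ^ n :: real)"
      using pow8[of n 3] by (simp add: power_mult_distrib)
    finally have "emeasure lborel (cbox (- (2 ^ n *\<^sub>R One)) (2 ^ n *\<^sub>R (One :: real^3))) = ennreal (8 * 8 ^ n)" .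
    then show "(\<integral>\<^sup>+z. ennreal (a n) * indicator (cbox (- (2 ^ n *\<^sub>R One)) (2 ^ n *\<^sub>R (One :: real^3))) z \<partial>lborel)
        = ennreal (256 * B * r ^ n)"
      using a_nn[of n] by (subst nn_integral_cmult_indicator) (simp_all only: sets_lborel borel_closed closed_cbox, simp add: a_def mult.assoc flip: ennreal_mult)
  qed
  finally have le: "(\<integral>\<^sup>+z. ennreal (F z * (1 + sqrt (norm z))) \<partial>lborel) \<le> (\<Sum>n. ennreal (256 * B * r ^ n))" .
  have fin: "(\<Sum>n. ennreal (256 * B * r ^ n)) < \<infinity>"
  proof -
    have "summable (\<lambda>n. 256 * B * r ^ n)"
      using r by (intro summable_mult summable_geometric) simp
    then have "(\<Sum>n. ennreal (256 * B * r ^ n)) = ennreal (\<Sum>n. 256 * B * r ^ n)"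
      using r \<open>B \<ge> 0\<close> by (intro suminf_ennreal2) simp_all
    then show ?thesis by simp
  qed
  show ?thesis by (rule le_less_trans[OF le fin])
qed

section \<open>A kernel majorant for the I-operator\<close>

definition dilate :: "(real^3 \<Rightarrow> real) \<Rightarrow> int \<Rightarrow> real^3 \<Rightarrow> real" where
  "dilate \<psi> j \<xi> = \<psi> ((1 / 2 powr real_of_int j) *\<^sub>R \<xi>)"

text \<open>The \<open>K\<^sub>j\<close> of the overview, that is, the convolution kernel of the
  projection to frequencies up to about 2^j.\<close>

definition lp_kernel :: "(real^3 \<Rightarrow> real) \<Rightarrow> int \<Rightarrow> real^3 \<Rightarrow> complex" where
  "lp_kernel \<psi> j = ift3 (\<lambda>\<xi>. complex_of_real (dilate \<psi> j \<xi>))"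

context
  fixes \<psi> :: "real^3 \<Rightarrow> real"
  assumes bump: "lp_bump \<psi>"
begin

lemma bump_smooth: "smooth3 \<psi>" and bump_support: "norm \<xi> > 2 \<Longrightarrow> \<psi> \<xi> = 0"
  using bump unfolding lp_bump_def by blast+

lemma bump_measurable [measurable]: "\<psi> \<in> borel_measurable borel"
  by (rule borel_measurable_continuous_onI[OF smooth3_continuous[OF bump_smooth]])

lemma continuous_dilate: "continuous_on UNIV (dilate \<psi> j)"
  unfolding dilate_def
  by (intro continuous_on_compose2[OF smooth3_continuous[OF bump_smooth]] continuous_intros) auto

lemma dilate_support: "norm \<xi> > 2 * 2 powr real_of_int j \<Longrightarrow> dilate \<psi> j \<xi> = 0"
  by (simp add: dilate_def bump_support field_simps)

lemma measurable_dilate [measurable]: "dilate \<psi> j \<in> borel_measurable borel"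
  by (rule borel_measurable_continuous_onI[OF continuous_dilate])

lemma integrable_dilate: "integrable lborel (dilate \<psi> j)"
  by (rule integrable_compact_support[OF continuous_dilate dilate_support])

lemma measurable_lp_kernel [measurable]: "lp_kernel \<psi> j \<in> borel_measurable borel"
proof -
  have "(\<lambda>(x, \<xi>). complex_of_real (dilate \<psi> j \<xi>) * cis (x \<bullet> \<xi>)) \<in> borel_measurable (borel \<Otimes>\<^sub>M lborel)"
    by measurable
  from lborel.borel_measurable_lebesgue_integral[OF this]
  show ?thesis
    unfolding lp_kernel_def ift3_def by (intro borel_measurable_times borel_measurable_const) simp
qed

lemma lp_kernel_scale:
  "lp_kernel \<psi> j z = 2 powr (3 * real_of_int j) *\<^sub>R lp_kernel \<psi> 0 (2 powr real_of_int j *\<^sub>R z)"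
proof -
  have "(2 powr real_of_int j) ^ 3 = 2 powr (3 * real_of_int j)"
    by (simp add: powr_power mult.commute)
  then show ?thesis
    unfolding lp_kernel_def ift3_def
    by (subst integral_lborel_affine[where c = "2 powr real_of_int j" and t = 0])
       (simp_all add: dilate_def scaleR_conv_of_real[where 'a = complex])
qed

text \<open>Boundedness together with decay of order 4 suffices, because 4 exceeds 3 + 1/2, the
  dimension plus the growth of the weight.\<close>

lemma lp_kernel_weight_finite:
  "(\<integral>\<^sup>+z. ennreal (norm (lp_kernel \<psi> 0 z) * (1 + sqrt (norm z))) \<partial>lborel) < \<infinity>"
proof -
  have ker: "lp_kernel \<psi> 0 z = of_real (1 / (2 * pi) ^ 3) * (\<integral>\<xi>. of_real (\<psi> \<xi>) * cis (z \<bullet> \<xi>) \<partial>lborel)" for z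
    by (simp add: lp_kernel_def ift3_def dilate_def)
  have "\<exists>C. \<forall>z. norm z ^ k * norm (lp_kernel \<psi> 0 z) \<le> C" for k
  proof -
    obtain C where C: "\<And>z. norm z ^ k * norm (\<integral>\<xi>. of_real (\<psi> \<xi>) * cis (z \<bullet> \<xi>) \<partial>lborel) \<le> C"
      using smooth3_ft_decay[OF bump_smooth bump_support] by blast
    have "norm z ^ k * norm (lp_kernel \<psi> 0 z) \<le> 1 / (2 * pi) ^ 3 * C" for z
      using mult_left_mono[OF C[of z], of "1 / (2 * pi) ^ 3"]
      by (simp add: ker norm_mult norm_divide norm_power mult_ac)
    then show ?thesis by blast
  qed
  note bnd = this
  obtain C0 where C0: "\<And>z. norm (lp_kernel \<psi> 0 z) \<le> C0"
    using bnd[of 0] unfolding power_0 mult_1 by blast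
  obtain C4 where C4: "\<And>z. norm z ^ 4 * norm (lp_kernel \<psi> 0 z) \<le> C4"
    using bnd[of 4] by blast
  show ?thesis
  proof (rule nn_integral_weighted_finite)
    show "0 \<le> norm (lp_kernel \<psi> 0 z)" for z by (rule norm_ge_zero)
    show "norm (lp_kernel \<psi> 0 z) \<le> max C0 C4" for z
      by (rule order_trans[OF C0 max.cobounded1])
    show "norm z ^ 4 * norm (lp_kernel \<psi> 0 z) \<le> max C0 C4" for z
      by (rule order_trans[OF C4 max.cobounded2])
  qed
qed

text \<open>The kernels are L1-normalised dilates of \<open>lp_kernel \<psi> 0\<close>, so with the
  weight taken at the kernel's own scale \<open>2 powr j\<close> the integral does not depend on
  \<open>j\<close>. For \<open>k \<le> j\<close> the weight at scale \<open>2 powr k\<close> is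
  smaller still.\<close>

lemma lp_kernel_weight:
  assumes "k \<le> j"
  shows "(\<integral>\<^sup>+z. ennreal (norm (lp_kernel \<psi> j z)) * ennreal (1 + sqrt (2 powr real_of_int k * norm z)) \<partial>lborel)
    \<le> (\<integral>\<^sup>+z. ennreal (norm (lp_kernel \<psi> 0 z) * (1 + sqrt (norm z))) \<partial>lborel)"
proof -
  define s where "s = 2 powr real_of_int j"
  have s: "s > 0" by (simp add: s_def)
  have s3: "s ^ 3 = 2 powr (3 * real_of_int j)"
    by (simp add: s_def powr_power mult.commute)
  have "(\<integral>\<^sup>+z. ennreal (norm (lp_kernel \<psi> j z)) * ennreal (1 + sqrt (2 powr real_of_int k * norm z)) \<partial>lborel)
     \<le> (\<integral>\<^sup>+z. ennreal (s ^ 3) * ennreal (norm (lp_kernel \<psi> 0 (s *\<^sub>R z)) * (1 + sqrt (norm (s *\<^sub>R z)))) \<partial>lborel)"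
  proof (rule nn_integral_mono)
    fix z :: "real^3"
    have "2 powr real_of_int k * norm z \<le> norm (s *\<^sub>R z)"
      using assms s by (simp add: s_def mult_right_mono)
    then have "norm (lp_kernel \<psi> j z) * (1 + sqrt (2 powr real_of_int k * norm z))
       \<le> s ^ 3 * (norm (lp_kernel \<psi> 0 (s *\<^sub>R z)) * (1 + sqrt (norm (s *\<^sub>R z))))"
      using s unfolding lp_kernel_scale[of j z] s3
      by (simp add: mult_left_mono flip: s_def mult.assoc)
    then show "ennreal (norm (lp_kernel \<psi> j z)) * ennreal (1 + sqrt (2 powr real_of_int k * norm z))
       \<le> ennreal (s ^ 3) * ennreal (norm (lp_kernel \<psi> 0 (s *\<^sub>R z)) * (1 + sqrt (norm (s *\<^sub>R z))))"
      using s by (simp add: ennreal_leI del: ennreal_plus flip: ennreal_mult)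
  qed
  also have "\<dots> = ennreal (s ^ 3) * (\<integral>\<^sup>+z. ennreal (norm (lp_kernel \<psi> 0 (s *\<^sub>R z)) * (1 + sqrt (norm (s *\<^sub>R z)))) \<partial>lborel)"
    by (rule nn_integral_cmult) measurable
  also have "\<dots> = (\<integral>\<^sup>+z. ennreal (norm (lp_kernel \<psi> 0 z) * (1 + sqrt (norm z))) \<partial>lborel)"
    using s by (subst nn_integral_lborel_affine[where c = s and t = 0]) simp_all
  finally show ?thesis .
qed

end

section \<open>Norm bounds for series and integrals; the Fourier transform of general
  functions\<close>

lemma norm_suminf_le_ennreal:
  fixes f :: "nat \<Rightarrow> 'a::banach"
  shows "ennreal (norm (\<Sum>n. f n)) \<le> (\<Sum>n. ennreal (norm (f n)))"
\<comment> \<open>Without absolute summability the right-hand side is infinite, whatever value the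
  series on the left has.\<close>
proof (cases "(\<Sum>n. ennreal (norm (f n))) = top")
  case False
  then have s: "summable (\<lambda>n. norm (f n))"
    by (intro summable_suminf_not_top) auto
  have "ennreal (norm (\<Sum>n. f n)) \<le> ennreal (\<Sum>n. norm (f n))"
    by (intro ennreal_leI summable_norm s)
  also have "\<dots> = (\<Sum>n. ennreal (norm (f n)))"
    by (intro suminf_ennreal2[symmetric] s) auto
  finally show ?thesis .
qed simp

text \<open>In the non-integrable case the Bochner integral is 0 by convention and the bound is
  trivial.\<close>

lemma norm_integral_le_nn_integral:
  fixes f :: "'a \<Rightarrow> 'b::{banach, second_countable_topology}"
  shows "ennreal (norm (\<integral>x. f x \<partial>M)) \<le> (\<integral>\<^sup>+x. ennreal (norm (f x)) \<partial>M)"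
  by (cases "integrable M f") (auto simp: integral_norm_bound_ennreal not_integrable_integral_eq)

lemma measurable_ft3:
  assumes [measurable]: "F \<in> borel_measurable borel"
  shows "ft3 F \<in> borel_measurable borel"
proof -
  have "(\<lambda>(\<xi>, x). F x * cis (- (x \<bullet> \<xi>))) \<in> borel_measurable (borel \<Otimes>\<^sub>M lborel)"
    by measurable
  from lborel.borel_measurable_lebesgue_integral[OF this]
  show ?thesis unfolding ft3_def[abs_def] by simp
qed

lemma norm_ft3_le: "norm (ft3 F \<xi>) \<le> (\<integral>x. norm (F x) \<partial>lborel)"
  unfolding ft3_def by (rule order_trans[OF integral_norm_bound]) (simp add: norm_mult)

text \<open>The factor \<open>cis\<close> has modulus 1, so the integrand is no more integrable than
  \<open>F\<close>, and its Bochner integral takes the default value 0.\<close>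

lemma ft3_not_integrable:
  assumes [measurable]: "F \<in> borel_measurable borel" and "\<not> integrable lborel F"
  shows "ft3 F \<xi> = 0"
proof -
  have "\<not> integrable lborel (\<lambda>x. F x * cis (- (x \<bullet> \<xi>)))"
  proof
    assume "integrable lborel (\<lambda>x. F x * cis (- (x \<bullet> \<xi>)))"
    then have "integrable lborel F"
      by (rule Bochner_Integration.integrable_bound) (auto simp: norm_mult)
    with assms(2) show False by simp
  qed
  then show ?thesis unfolding ft3_def by (rule not_integrable_integral_eq)
qed

section \<open>Frequency cutoffs as convolutions and the majorant of the I-operator\<close>

definition lp_cutoff :: "(real^3 \<Rightarrow> real) \<Rightarrow> int \<Rightarrow> (real^3 \<Rightarrow> complex) \<Rightarrow> real^3 \<Rightarrow> complex" where
  "lp_cutoff \<psi> j F = ift3 (\<lambda>\<xi>. complex_of_real (dilate \<psi> j \<xi>) * ft3 F \<xi>)"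

definition abs_conv :: "(real^3 \<Rightarrow> ennreal) \<Rightarrow> (real^3 \<Rightarrow> complex) \<Rightarrow> real^3 \<Rightarrow> ennreal" where
  "abs_conv K F x = (\<integral>\<^sup>+y. K (x - y) * ennreal (norm (F y)) \<partial>lborel)"

definition Iop_weight :: "real \<Rightarrow> nat \<Rightarrow> real" where
  "Iop_weight \<epsilon> n = 2 powr (- real (Suc n) * (1/2 - \<epsilon>))"

text \<open>Term \<open>n\<close> serves the piece of frequency index
  \<open>int (Suc n) + k\<close>, a difference of two adjacent cutoffs, whence the pair of
  kernels.\<close>

definition Iop_majorant :: "(real^3 \<Rightarrow> real) \<Rightarrow> real \<Rightarrow> int \<Rightarrow> real^3 \<Rightarrow> ennreal" where
  "Iop_majorant \<psi> \<epsilon> k z = ennreal (norm (lp_kernel \<psi> k z))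
     + (\<Sum>n. ennreal (Iop_weight \<epsilon> n) *
         (ennreal (norm (lp_kernel \<psi> (int (Suc n) + k) z)) + ennreal (norm (lp_kernel \<psi> (int n + k) z))))"

text \<open>A geometric series with ratio \<open>2 powr (- (1/2 - \<epsilon>))\<close>, which is
  below 1 because \<open>\<epsilon> < 1/2\<close>.\<close>

lemma summable_Iop_weight:
  assumes "\<epsilon> < 1/2"
  shows "summable (Iop_weight \<epsilon>)"
proof -
  have "(2 powr a) ^ Suc n = 2 powr (a * real (Suc n))" for a :: real and n
    by (simp add: powr_power mult.commute del: power_Suc)
  then have "Iop_weight \<epsilon> n = (2 powr (- (1/2 - \<epsilon>))) ^ Suc n" for n
    by (simp only: Iop_weight_def mult_minus_left mult_minus_right mult.commute)
  then have "Iop_weight \<epsilon> = (\<lambda>n. 2 powr (- (1/2 - \<epsilon>)) * (2 powr (- (1/2 - \<epsilon>))) ^ n)"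
    by (simp add: fun_eq_iff)
  moreover have "norm (2 powr (- (1/2 - \<epsilon>)) :: real) < 1"
    using assms powr_less_mono[of "- (1/2 - \<epsilon>)" 0 2] by simp
  ultimately show ?thesis
    by (simp only: summable_mult summable_geometric)
qed

context
  fixes \<psi> :: "real^3 \<Rightarrow> real"
  assumes bump: "lp_bump \<psi>"
begin

lemmas [measurable] = bump_measurable[OF bump] measurable_dilate[OF bump] measurable_lp_kernel[OF bump]

text \<open>Fubini: the dilated bump and \<open>F\<close> are both integrable, so the double
  integral converges absolutely, and integrating in \<open>\<xi>\<close> first produces the
  kernel.\<close>

lemma lp_cutoff_conv:
  assumes F: "integrable lborel F"
  shows "lp_cutoff \<psi> j F x = (\<integral>y. F y * lp_kernel \<psi> j (x - y) \<partial>lborel)"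
proof -
  have [measurable]: "F \<in> borel_measurable borel" using F by auto
  define u where "u \<xi> y = complex_of_real (dilate \<psi> j \<xi>) * F y * cis ((x - y) \<bullet> \<xi>)" for \<xi> y
  have [measurable]: "case_prod u \<in> borel_measurable (lborel \<Otimes>\<^sub>M lborel)"
    unfolding u_def by measurable
  have "integrable lborel (\<lambda>\<xi>. \<integral>y. norm (u \<xi> y) \<partial>lborel)"
    using integrable_dilate[OF bump, of j] by (simp add: u_def norm_mult)
  moreover have "integrable lborel (u \<xi>)" for \<xi>
    by (rule Bochner_Integration.integrable_bound[of _ "\<lambda>y. complex_of_real (dilate \<psi> j \<xi>) * F y"])
       (use F in \<open>auto simp: u_def[abs_def] norm_mult\<close>)
  ultimately have int: "integrable (lborel \<Otimes>\<^sub>M lborel) (case_prod u)"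
    by (intro lborel_pair.Fubini_integrable) auto
  have "(\<integral>\<xi>. complex_of_real (dilate \<psi> j \<xi>) * ft3 F \<xi> * cis (x \<bullet> \<xi>) \<partial>lborel) = (\<integral>\<xi>. (\<integral>y. u \<xi> y \<partial>lborel) \<partial>lborel)"
  proof (rule Bochner_Integration.integral_cong[OF refl])
    fix \<xi>
    have "u \<xi> y = complex_of_real (dilate \<psi> j \<xi>) * cis (x \<bullet> \<xi>) * (F y * cis (- (y \<bullet> \<xi>)))" for y
      by (simp add: u_def inner_diff_left cis_divide[symmetric] divide_inverse)
    then have "(\<integral>y. u \<xi> y \<partial>lborel) = complex_of_real (dilate \<psi> j \<xi>) * cis (x \<bullet> \<xi>) * ft3 F \<xi>"
      unfolding ft3_def by (simp only: integral_mult_right_zero)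
    then show "complex_of_real (dilate \<psi> j \<xi>) * ft3 F \<xi> * cis (x \<bullet> \<xi>) = (\<integral>y. u \<xi> y \<partial>lborel)"
      by simp
  qed
  also have "\<dots> = (\<integral>y. (\<integral>\<xi>. u \<xi> y \<partial>lborel) \<partial>lborel)"
    using lborel_pair.Fubini_integral[OF int] by simp
  also have "\<dots> = (\<integral>y. F y * (\<integral>\<xi>. complex_of_real (dilate \<psi> j \<xi>) * cis ((x - y) \<bullet> \<xi>) \<partial>lborel) \<partial>lborel)"
  proof (rule Bochner_Integration.integral_cong[OF refl])
    fix y
    have "u \<xi> y = F y * (complex_of_real (dilate \<psi> j \<xi>) * cis ((x - y) \<bullet> \<xi>))" for \<xi>
      by (simp add: u_def)
    then show "(\<integral>\<xi>. u \<xi> y \<partial>lborel) = F y * (\<integral>\<xi>. complex_of_real (dilate \<psi> j \<xi>) * cis ((x - y) \<bullet> \<xi>) \<partial>lborel)"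
      by simp
  qed
  finally show ?thesis
    unfolding lp_cutoff_def lp_kernel_def ift3_def
    by (simp add: mult.left_commute[of _ "complex_of_real _"] del: of_real_divide of_real_power)
qed

lemma norm_lp_cutoff_le:
  assumes F: "integrable lborel F"
  shows "ennreal (norm (lp_cutoff \<psi> j F x)) \<le> abs_conv (\<lambda>z. ennreal (norm (lp_kernel \<psi> j z))) F x"
  unfolding lp_cutoff_conv[OF F] abs_conv_def
  by (rule order_trans[OF norm_integral_le_nn_integral]) (simp add: norm_mult ennreal_mult mult.commute)

text \<open>\<open>ft3 F\<close> is bounded by the L1 norm of \<open>F\<close>, so a multiple of the
  dilated bump dominates. This permits splitting the integral defining \<open>LP\<close> into
  two.\<close>

lemma integrable_lp_cutoff:
  assumes F: "integrable lborel F"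
  shows "integrable lborel (\<lambda>\<xi>. complex_of_real (dilate \<psi> j \<xi>) * ft3 F \<xi> * cis (x \<bullet> \<xi>))"
proof (rule Bochner_Integration.integrable_bound)
  have [measurable]: "F \<in> borel_measurable borel" using F by auto
  note [measurable] = measurable_ft3[OF this]
  show "integrable lborel (\<lambda>\<xi>. dilate \<psi> j \<xi> * (\<integral>x. norm (F x) \<partial>lborel))"
    using integrable_dilate[OF bump] by simp
  show "(\<lambda>\<xi>. complex_of_real (dilate \<psi> j \<xi>) * ft3 F \<xi> * cis (x \<bullet> \<xi>)) \<in> borel_measurable lborel"
    by measurable
  show "AE \<xi> in lborel. norm (complex_of_real (dilate \<psi> j \<xi>) * ft3 F \<xi> * cis (x \<bullet> \<xi>))
      \<le> norm (dilate \<psi> j \<xi> * (\<integral>x. norm (F x) \<partial>lborel))"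
    using norm_ft3_le[of F] by (auto simp: norm_mult abs_mult intro!: mult_left_mono)
qed

lemma LP_eq_diff:
  assumes F: "integrable lborel F"
  shows "LP \<psi> j F x = lp_cutoff \<psi> j F x - lp_cutoff \<psi> (j - 1) F x"
proof -
  \<comment> \<open>As \<open>2 / 2 powr j = 1 / 2 powr (j - 1)\<close>, the subtracted bump is the
    dilate of index \<open>j - 1\<close>.\<close>
  have "\<psi> ((2 / 2 powr real_of_int j) *\<^sub>R \<xi>) = dilate \<psi> (j - 1) \<xi>" for \<xi>
    by (simp add: dilate_def powr_diff)
  then show ?thesis
    unfolding LP_def lp_cutoff_def ift3_def
    by (subst right_diff_distrib[symmetric], subst Bochner_Integration.integral_diff[symmetric])
       (simp_all add: integrable_lp_cutoff[OF F] dilate_def[of _ j, symmetric] left_diff_distrib)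
qed

text \<open>Supplies the limit for telescoping. \<open>ft3 F\<close> is bounded while the L1 norm of
  the dilated bump scales like 2^(3j), so each step down in frequency gains a factor 1/8.\<close>

lemma lp_cutoff_tendsto_0:
  assumes F: "integrable lborel F"
  shows "(\<lambda>n. lp_cutoff \<psi> (k - int n) F x) \<longlonglongrightarrow> 0"
proof (rule Lim_null_comparison)
  define C where "C = (1 / (2 * pi) ^ 3) * ((\<integral>\<xi>. \<bar>\<psi> \<xi>\<bar> \<partial>lborel) * (\<integral>x. norm (F x) \<partial>lborel))"
  have bound: "norm (lp_cutoff \<psi> j F x) \<le> C * (2 powr real_of_int j) ^ 3" for j
  proof -
    have "norm (\<integral>\<xi>. complex_of_real (dilate \<psi> j \<xi>) * ft3 F \<xi> * cis (x \<bullet> \<xi>) \<partial>lborel)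
       \<le> (\<integral>\<xi>. norm (complex_of_real (dilate \<psi> j \<xi>) * ft3 F \<xi> * cis (x \<bullet> \<xi>)) \<partial>lborel)"
      by (rule integral_norm_bound)
    also have "\<dots> \<le> (\<integral>\<xi>. \<bar>dilate \<psi> j \<xi>\<bar> * (\<integral>x. norm (F x) \<partial>lborel) \<partial>lborel)"
      by (rule integral_mono)
         (use integrable_norm[OF integrable_lp_cutoff[OF F]] integrable_dilate[OF bump, of j] norm_ft3_le[of F]
          in \<open>auto simp: norm_mult intro!: mult_left_mono\<close>)
    also have "\<dots> = (\<integral>\<xi>. \<bar>dilate \<psi> j \<xi>\<bar> \<partial>lborel) * (\<integral>x. norm (F x) \<partial>lborel)"
      by simp
    also have "(\<integral>\<xi>. \<bar>dilate \<psi> j \<xi>\<bar> \<partial>lborel) = (2 powr real_of_int j) ^ 3 * (\<integral>\<xi>. \<bar>\<psi> \<xi>\<bar> \<partial>lborel)"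
      by (subst integral_lborel_affine[where c = "2 powr real_of_int j" and t = 0])
         (simp_all add: dilate_def)
    finally show ?thesis
      unfolding lp_cutoff_def ift3_def C_def norm_mult norm_of_real
      by (simp add: divide_right_mono mult_ac)
  qed
  show "\<forall>\<^sub>F n in sequentially. norm (lp_cutoff \<psi> (k - int n) F x) \<le> C * ((2 powr real_of_int k) ^ 3 * (1/8) ^ n)"
  proof (rule always_eventually, rule allI)
    fix n
    have "(2 powr real_of_int (k - int n)) ^ 3 = (2 powr real_of_int k) ^ 3 * (1/8::real) ^ n"
    proof -
      have "2 powr real_of_int (k - int n) = 2 powr real_of_int k * (1/2) ^ n"
        by (simp add: powr_diff powr_realpow power_one_over)
      moreover have "((1/2 :: real) ^ n) ^ 3 = (1/8) ^ n"
        by (simp add: power_one_over power_mult[symmetric] mult.commute[of n]) (simp add: power_mult)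
      ultimately show ?thesis by (simp only: power_mult_distrib)
    qed
    with bound[of "k - int n"] show "norm (lp_cutoff \<psi> (k - int n) F x) \<le> C * ((2 powr real_of_int k) ^ 3 * (1/8) ^ n)"
      by simp
  qed
  show "(\<lambda>n. C * ((2 powr real_of_int k) ^ 3 * (1/8) ^ n)) \<longlonglongrightarrow> 0"
    by (intro tendsto_mult_right_zero LIMSEQ_power_zero) simp
qed

text \<open>Telescoping leaves only the top cutoff, so the whole low-frequency part costs a single
  kernel.\<close>

lemma LP_le_eq:
  assumes F: "integrable lborel F"
  shows "LP_le \<psi> k F x = lp_cutoff \<psi> k F x"
proof -
  have "(\<lambda>n. lp_cutoff \<psi> (k - int n) F x - lp_cutoff \<psi> (k - int (Suc n)) F x) sums (lp_cutoff \<psi> (k - int 0) F x - 0)"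
    by (rule telescope_sums'[OF lp_cutoff_tendsto_0[OF F]])
  then show ?thesis
    unfolding LP_le_def LP_eq_diff[OF F] by (simp add: sums_iff algebra_simps)
qed

lemma measurable_Iop_majorant [measurable]: "Iop_majorant \<psi> \<epsilon> k \<in> borel_measurable borel"
  unfolding Iop_majorant_def[abs_def] by measurable

lemma norm_Iop_le:
  assumes [measurable]: "F \<in> borel_measurable borel"
  shows "ennreal (norm (Iop \<psi> \<epsilon> k F x)) \<le> abs_conv (Iop_majorant \<psi> \<epsilon> k) F x"
proof (cases "integrable lborel F")
  case True
  define A where "A j = abs_conv (\<lambda>z. ennreal (norm (lp_kernel \<psi> j z))) F x" for j
  have cut: "ennreal (norm (lp_cutoff \<psi> j F x)) \<le> A j" for j
    unfolding A_def by (rule norm_lp_cutoff_le[OF True])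
  have w: "Iop_weight \<epsilon> n \<ge> 0" for n by (simp add: Iop_weight_def)
  have LP: "ennreal (norm (LP \<psi> j F x)) \<le> A j + A (j - 1)" for j
  proof -
    have "ennreal (norm (LP \<psi> j F x)) \<le> ennreal (norm (lp_cutoff \<psi> j F x) + norm (lp_cutoff \<psi> (j - 1) F x))"
      unfolding LP_eq_diff[OF True] by (intro ennreal_leI norm_triangle_ineq4)
    also have "\<dots> \<le> A j + A (j - 1)" using cut by (simp add: add_mono)
    finally show ?thesis .
  qed
  have "ennreal (norm (Iop \<psi> \<epsilon> k F x)) \<le> ennreal (norm (lp_cutoff \<psi> k F x))
      + ennreal (norm (\<Sum>n. complex_of_real (Iop_weight \<epsilon> n) * LP \<psi> (int (Suc n) + k) F x))"
    unfolding Iop_def LP_le_eq[OF True] Iop_weight_def[symmetric]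
    by (rule order_trans[OF ennreal_leI[OF norm_triangle_ineq]]) simp
  also have "\<dots> \<le> A k + (\<Sum>n. ennreal (norm (complex_of_real (Iop_weight \<epsilon> n) * LP \<psi> (int (Suc n) + k) F x)))"
    by (intro add_mono cut norm_suminf_le_ennreal)
  also have "\<dots> \<le> A k + (\<Sum>n. ennreal (Iop_weight \<epsilon> n) * (A (int (Suc n) + k) + A (int n + k)))"
  proof (intro add_left_mono suminf_le summableI)
    fix n
    show "ennreal (norm (complex_of_real (Iop_weight \<epsilon> n) * LP \<psi> (int (Suc n) + k) F x))
       \<le> ennreal (Iop_weight \<epsilon> n) * (A (int (Suc n) + k) + A (int n + k))"
      using LP[of "int (Suc n) + k"] w[of n] by (simp add: norm_mult ennreal_mult mult_left_mono)
  qed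
  \<comment> \<open>All terms are nonnegative, so the series and the convolution integral may be
    exchanged, and the separate bounds reassemble into one convolution.\<close>
  also have "\<dots> = abs_conv (Iop_majorant \<psi> \<epsilon> k) F x"
    unfolding A_def abs_conv_def Iop_majorant_def
    by (simp add: distrib_right nn_integral_add nn_integral_cmult nn_integral_suminf mult.assoc
             flip: ennreal_suminf_multc)
  finally show ?thesis .
next
  case False
  then have "LP \<psi> j F x = 0" for j x
    by (simp add: LP_def ift3_def ft3_not_integrable)
  then show ?thesis by (simp add: Iop_def LP_le_def)
qed

text \<open>Even the lower kernel of each pair has index at least \<open>k\<close>, so
  \<open>lp_kernel_weight\<close> bounds every weighted integral by the same \<open>V\<close>. What
  remains is the convergent sum of the weights, doubled because the kernels come in pairs.\<close>

lemma Iop_majorant_weight_bounded: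
  assumes "\<epsilon> < 1/2"
  shows "\<exists>W::real. W > 0 \<and> (\<forall>k. (\<integral>\<^sup>+z. Iop_majorant \<psi> \<epsilon> k z * ennreal (1 + sqrt (2 powr real_of_int k * norm z)) \<partial>lborel) \<le> ennreal W)"
proof -
  define V where "V = (\<integral>\<^sup>+z. ennreal (norm (lp_kernel \<psi> 0 z) * (1 + sqrt (norm z))) \<partial>lborel)"
  define S where "S = (\<Sum>n. Iop_weight \<epsilon> n)"
  have w: "Iop_weight \<epsilon> n \<ge> 0" for n by (simp add: Iop_weight_def)
  have S: "S \<ge> 0" "(\<Sum>n. ennreal (Iop_weight \<epsilon> n)) = ennreal S"
    unfolding S_def using w summable_Iop_weight[OF assms] by (auto intro: suminf_nonneg suminf_ennreal2)
  have "V < \<infinity>" unfolding V_def by (rule lp_kernel_weight_finite[OF bump])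
  then obtain v where v: "V = ennreal v" "v \<ge> 0" by (cases V) auto
  have "(\<integral>\<^sup>+z. Iop_majorant \<psi> \<epsilon> k z * ennreal (1 + sqrt (2 powr real_of_int k * norm z)) \<partial>lborel)
     \<le> ennreal (v + 2 * S * v + 1)" for k
  proof -
    define B where "B j = (\<integral>\<^sup>+z. ennreal (norm (lp_kernel \<psi> j z)) * ennreal (1 + sqrt (2 powr real_of_int k * norm z)) \<partial>lborel)" for j
    have B: "B j \<le> V" if "k \<le> j" for j
      unfolding B_def V_def by (rule lp_kernel_weight[OF bump that])
    have "(\<integral>\<^sup>+z. Iop_majorant \<psi> \<epsilon> k z * ennreal (1 + sqrt (2 powr real_of_int k * norm z)) \<partial>lborel)
      = B k + (\<Sum>n. ennreal (Iop_weight \<epsilon> n) * (B (int (Suc n) + k) + B (int n + k)))"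
      unfolding B_def Iop_majorant_def
      by (simp add: distrib_right nn_integral_add nn_integral_cmult nn_integral_suminf mult.assoc
               del: ennreal_plus flip: ennreal_suminf_multc)
    also have "\<dots> \<le> V + (\<Sum>n. ennreal (Iop_weight \<epsilon> n) * (V + V))"
      by (intro add_mono suminf_le summableI mult_left_mono B) auto
    also have "\<dots> = V + ennreal S * (V + V)" by (simp add: ennreal_suminf_multc S)
    also have "\<dots> = ennreal (v + 2 * S * v)"
      using v S by (simp add: algebra_simps flip: ennreal_mult ennreal_plus)
    also have "\<dots> \<le> ennreal (v + 2 * S * v + 1)" by (intro ennreal_leI) simp
    finally show ?thesis .
  qed
  \<comment> \<open>The summand 1 makes the witness strictly positive.\<close>
  then show ?thesis using v S by (intro exI[of _ "v + 2 * S * v + 1"]) (auto intro!: add_nonneg_pos)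
qed

end

section \<open>The bilinear estimate\<close>

lemma ennreal_power2_le_imp_le:
  fixes x y :: ennreal
  assumes "x\<^sup>2 \<le> y\<^sup>2"
  shows "x \<le> y"
proof (cases y)
  case (real b)
  show ?thesis
  proof (cases x)
    case (real a)
    with assms \<open>y = ennreal b\<close> \<open>0 \<le> b\<close> show ?thesis
      by (auto simp: ennreal_power intro!: ennreal_leI power2_le_imp_le)
  next
    case top
    with assms \<open>y = ennreal b\<close> \<open>0 \<le> b\<close> show ?thesis
      by (simp add: ennreal_power top_power_ennreal top_unique)
  qed
qed simp

lemma esqrt_power2 [simp]: "(esqrt a)\<^sup>2 = a"
  by (cases a) (auto simp: esqrt_def power2_eq_square ennreal_top_mult simp flip: ennreal_mult)

lemma esqrt_mono: "a \<le> b \<Longrightarrow> esqrt a \<le> esqrt b"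
  by (rule ennreal_power2_le_imp_le) simp

lemma Cauchy_Schwarz_esqrt:
  assumes "f \<in> borel_measurable M" "g \<in> borel_measurable M"
  shows "(\<integral>\<^sup>+x. f x * g x \<partial>M) \<le> esqrt (\<integral>\<^sup>+x. (f x)\<^sup>2 \<partial>M) * esqrt (\<integral>\<^sup>+x. (g x)\<^sup>2 \<partial>M)"
  by (rule ennreal_power2_le_imp_le) (use Cauchy_Schwarz_nn_integral[OF assms] in \<open>simp add: power_mult_distrib\<close>)

text \<open>Tonelli and a translation in space turn the pairing with a convolution into an average
  over shifts \<open>z\<close> with weight \<open>K z\<close>. An estimate at each fixed shift is
  then enough.\<close>

lemma nn_integral_abs_conv:
  fixes F :: "real \<times> (real^3) \<Rightarrow> complex"
  assumes [measurable]: "K \<in> borel_measurable borel" "F \<in> borel_measurable borel" "v \<in> borel_measurable borel"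
  shows "(\<integral>\<^sup>+p. abs_conv K (\<lambda>y. F (fst p, y)) (snd p) * v p \<partial>lborel)
    = (\<integral>\<^sup>+z. K z * (\<integral>\<^sup>+p. ennreal (norm (F p)) * v (p + (0, z)) \<partial>lborel) \<partial>lborel)"
proof -
  have "abs_conv K (\<lambda>y. F (fst p, y)) (snd p) * v p
      = (\<integral>\<^sup>+z. K z * ennreal (norm (F (p - (0, z)))) * v p \<partial>lborel)" for p
  proof -
    have "abs_conv K (\<lambda>y. F (fst p, y)) (snd p)
        = (\<integral>\<^sup>+z. K z * ennreal (norm (F (p - (0, z)))) \<partial>lborel)"
      unfolding abs_conv_def
      by (subst nn_integral_lborel_affine[where c = "-1" and t = "snd p"])
         (simp_all add: minus_prod_def)
    then show ?thesis by (simp add: nn_integral_multc)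
  qed
  then have "(\<integral>\<^sup>+p. abs_conv K (\<lambda>y. F (fst p, y)) (snd p) * v p \<partial>lborel)
      = (\<integral>\<^sup>+p. (\<integral>\<^sup>+z. K z * ennreal (norm (F (p - (0, z)))) * v p \<partial>lborel) \<partial>lborel)"
    by simp
  also have "\<dots> = (\<integral>\<^sup>+z. (\<integral>\<^sup>+p. K z * ennreal (norm (F (p - (0, z)))) * v p \<partial>lborel) \<partial>lborel)"
    by (rule lborel_pair.Fubini'[symmetric]) measurable
  also have "\<dots> = (\<integral>\<^sup>+z. K z * (\<integral>\<^sup>+p. ennreal (norm (F p)) * v (p + (0, z)) \<partial>lborel) \<partial>lborel)"
  proof (rule nn_integral_cong)
    fix z :: "real^3"
    have "(\<integral>\<^sup>+p. K z * ennreal (norm (F (p - (0, z)))) * v p \<partial>lborel)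
       = K z * (\<integral>\<^sup>+p. ennreal (norm (F (p - (0, z)))) * v p \<partial>lborel)"
      by (simp add: mult.assoc nn_integral_cmult)
    also have "(\<integral>\<^sup>+p. ennreal (norm (F (p - (0, z)))) * v p \<partial>lborel)
       = (\<integral>\<^sup>+p. ennreal (norm (F p)) * v (p + (0, z)) \<partial>lborel)"
      by (subst nn_integral_lborel_affine[where c = 1 and t = "(0, z)"]) (simp_all add: add.commute)
    finally show "(\<integral>\<^sup>+p. K z * ennreal (norm (F (p - (0, z)))) * v p \<partial>lborel)
       = K z * (\<integral>\<^sup>+p. ennreal (norm (F p)) * v (p + (0, z)) \<partial>lborel)" .
  qed
  finally show ?thesis .
qed

section \<open>Local L2 norms and dyadic shells\<close>

lemma L2norm_on_mono: "B \<subseteq> C \<Longrightarrow> L2norm_on J B u \<le> L2norm_on J C u"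
  unfolding L2norm_on_def
  by (intro esqrt_mono nn_integral_mono mult_left_mono) (auto simp: indicator_def)

text \<open>\<open>linfL2norm\<close> sees only dyadic radii, so \<open>R\<close> is rounded up to
  \<open>2 powr m\<close>, which at most doubles it; this is the 2 under the root. The lower bound
  on \<open>R\<close> makes \<open>m\<close> an admissible index,
  \<open>m \<ge> - k0\<close>.\<close>

lemma L2norm_on_cball_le:
  assumes "2 powr - real_of_int k0 \<le> R"
  shows "L2norm_on J (cball 0 R) f \<le> ennreal (sqrt (2 * R)) * linfL2norm k0 J f"
proof -
  have R: "R > 0" using assms by (rule less_le_trans[rotated]) simp
  define m where "m = \<lceil>log 2 R\<rceil>"
  have "- real_of_int k0 = log 2 (2 powr - real_of_int k0)" by simp
  also have "\<dots> \<le> log 2 R" using assms R by (subst log_le_cancel_iff) auto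
  also have "\<dots> \<le> real_of_int m" by (simp add: m_def)
  finally have km: "- k0 \<le> m" by linarith
  have Rm: "R \<le> 2 powr real_of_int m"
    using R by (simp add: m_def le_powr_iff ceiling_correct)
  have mR: "2 powr real_of_int m \<le> 2 * R"
  proof -
    have "2 powr real_of_int m \<le> 2 powr (log 2 R + 1)"
      unfolding m_def by (intro powr_mono) (use ceiling_correct[of "log 2 R"] in linarith)+
    also have "\<dots> = 2 * R" using R by (simp add: powr_add)
    finally show ?thesis .
  qed
  have "L2norm_on J (cball 0 R) f \<le> L2norm_on J (cball 0 (2 powr real_of_int m)) f"
    using Rm by (intro L2norm_on_mono subset_cball)
  also have "\<dots> = ennreal (2 powr (real_of_int m / 2)) * (ennreal (2 powr (- real_of_int m / 2)) * L2norm_on J (cball 0 (2 powr real_of_int m)) f)"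
  proof -
    have "ennreal (2 powr (real_of_int m / 2)) * ennreal (2 powr (- real_of_int m / 2)) = 1"
      by (simp add: powr_minus flip: ennreal_mult)
    then show ?thesis by (simp flip: mult.assoc)
  qed
  also have "\<dots> \<le> ennreal (sqrt (2 * R)) * linfL2norm k0 J f"
  proof (rule mult_mono)
    have "2 powr (real_of_int m / 2) = sqrt (2 powr real_of_int m)"
      by (simp add: powr_half_sqrt[symmetric] powr_powr)
    with mR show "ennreal (2 powr (real_of_int m / 2)) \<le> ennreal (sqrt (2 * R))"
      by (intro ennreal_leI) simp
    show "ennreal (2 powr (- real_of_int m / 2)) * L2norm_on J (cball 0 (2 powr real_of_int m)) f \<le> linfL2norm k0 J f"
      unfolding linfL2norm_def by (rule SUP_upper) (use km in simp)
  qed auto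
  finally show ?thesis .
qed

lemma measurable_indicator_fst:
    "A \<in> sets borel \<Longrightarrow> (\<lambda>p. indicator A (fst p) :: ennreal) \<in> borel_measurable (borel :: ('a::topological_space \<times> 'b::topological_space) measure)"
  and measurable_indicator_snd:
    "B \<in> sets borel \<Longrightarrow> (\<lambda>p. indicator B (snd p) :: ennreal) \<in> borel_measurable (borel :: ('a \<times> 'b) measure)"
  by (rule measurable_compose[OF borel_measurable_continuous_onI borel_measurable_indicator];
      simp add: continuous_on_fst continuous_on_snd continuous_on_id)+

text \<open>Cauchy-Schwarz in space-time, then translation by \<open>z\<close>, which carries the
  ball of radius \<open>r\<close> into the one of radius \<open>r + norm z\<close>. That radius is
  still large enough for \<open>L2norm_on_cball_le\<close>.\<close>

lemma shell_estimate:
  fixes f g :: "real \<times> (real^3) \<Rightarrow> complex"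
  assumes [measurable]: "J \<in> sets borel" "f \<in> borel_measurable borel" "g \<in> borel_measurable borel"
    and r: "2 powr - real_of_int k0 \<le> r"
  shows "(\<integral>\<^sup>+p. (ennreal (norm (g p)) * indicator J (fst p)) *
       (ennreal (norm (f (p + (0, z)))) * indicator J (fst p) * indicator (cball 0 r) (snd p)) \<partial>lborel)
    \<le> L2norm_on J UNIV (\<lambda>t x. g (t, x)) * (ennreal (sqrt (2 * (r + norm z))) * linfL2norm k0 J (\<lambda>t x. f (t, x)))"
proof -
  have "(\<integral>\<^sup>+p. (ennreal (norm (g p)) * indicator J (fst p)) *
       (ennreal (norm (f (p + (0, z)))) * indicator J (fst p) * indicator (cball 0 r) (snd p)) \<partial>lborel)
    \<le> esqrt (\<integral>\<^sup>+p. (ennreal (norm (g p)) * indicator J (fst p))\<^sup>2 \<partial>lborel) *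
      esqrt (\<integral>\<^sup>+p. (ennreal (norm (f (p + (0, z)))) * indicator J (fst p) * indicator (cball 0 r) (snd p))\<^sup>2 \<partial>lborel)"
    by (intro Cauchy_Schwarz_esqrt borel_measurable_times_ennreal)
       (simp_all add: measurable_indicator_fst measurable_indicator_snd)
  also have "\<dots> \<le> L2norm_on J UNIV (\<lambda>t x. g (t, x)) * L2norm_on J (cball 0 (r + norm z)) (\<lambda>t x. f (t, x))"
  proof (rule mult_mono)
    show "esqrt (\<integral>\<^sup>+p. (ennreal (norm (g p)) * indicator J (fst p))\<^sup>2 \<partial>lborel) \<le> L2norm_on J UNIV (\<lambda>t x. g (t, x))"
      unfolding L2norm_on_def by (intro esqrt_mono nn_integral_mono) (auto simp: indicator_def ennreal_power)
    have meas: "(\<lambda>p. ennreal ((norm (f p))\<^sup>2) * indicator J (fst p) * indicator (cball 0 (r + norm z)) (snd p)) \<in> borel_measurable borel"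
      by (intro borel_measurable_times_ennreal) (simp_all add: measurable_indicator_fst measurable_indicator_snd)
    have "(\<integral>\<^sup>+p. (ennreal (norm (f (p + (0, z)))) * indicator J (fst p) * indicator (cball 0 r) (snd p))\<^sup>2 \<partial>lborel)
       \<le> (\<integral>\<^sup>+p. ennreal ((norm (f (p + (0, z))))\<^sup>2) * indicator J (fst p) * indicator (cball 0 (r + norm z)) (snd p + z) \<partial>lborel)"
    proof (rule nn_integral_mono)
      fix p :: "real \<times> (real^3)"
      have "norm (snd p + z) \<le> r + norm z" if "norm (snd p) \<le> r"
        using that norm_triangle_ineq[of "snd p" z] by linarith
      then show "(ennreal (norm (f (p + (0, z)))) * indicator J (fst p) * indicator (cball 0 r) (snd p))\<^sup>2
         \<le> ennreal ((norm (f (p + (0, z))))\<^sup>2) * indicator J (fst p) * indicator (cball 0 (r + norm z)) (snd p + z)"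
        by (auto simp: indicator_def ennreal_power)
    qed
    also have "\<dots> = (\<integral>\<^sup>+p. ennreal ((norm (f p))\<^sup>2) * indicator J (fst p) * indicator (cball 0 (r + norm z)) (snd p) \<partial>lborel)"
      by (subst (2) nn_integral_lborel_affine[where c = 1 and t = "(0, z)"]) (simp_all add: add.commute meas)
    finally show "esqrt (\<integral>\<^sup>+p. (ennreal (norm (f (p + (0, z)))) * indicator J (fst p) * indicator (cball 0 r) (snd p))\<^sup>2 \<partial>lborel)
       \<le> L2norm_on J (cball 0 (r + norm z)) (\<lambda>t x. f (t, x))"
      unfolding L2norm_on_def prod.collapse by (rule esqrt_mono)
  qed auto
  also have "\<dots> \<le> L2norm_on J UNIV (\<lambda>t x. g (t, x)) * (ennreal (sqrt (2 * (r + norm z))) * linfL2norm k0 J (\<lambda>t x. f (t, x)))"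
    using r by (intro mult_left_mono L2norm_on_cball_le) (auto intro: order_trans)
  finally show ?thesis .
qed

text \<open>An upper bound for \<open>exp (- c * norm y)\<close> on the \<open>n\<close>-th shell \<open>2 powr (n - k - 1) \<le> norm y \<le> 2 powr (n - k)\<close> (for \<open>n = 0\<close>, the whole ball).\<close>

definition shell_weight :: "real \<Rightarrow> int \<Rightarrow> nat \<Rightarrow> real" where
  "shell_weight c k n = (if n \<le> nat k then 1 else exp (- c) ^ (n - nat k - 1))"

lemma shell_weight_nonneg: "shell_weight c k n \<ge> 0"
  by (simp add: shell_weight_def)

text \<open>The first \<open>nat k + 1\<close> indices have weight 1 and the rest form a geometric
  series. This count is the source of the factor \<open>|k|\<close> in the theorem.\<close>

lemma sums_shell_weight:
  assumes "c > 0"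
  shows "shell_weight c k sums (real (nat k) + 1 + 1 / (1 - exp (- c)))"
proof -
  have "(\<lambda>n. shell_weight c k (n + (nat k + 1))) sums (1 / (1 - exp (- c)))"
    using geometric_sums[of "exp (- c)"] assms by (simp add: shell_weight_def)
  then have "shell_weight c k sums (1 / (1 - exp (- c)) + (\<Sum>n<nat k + 1. shell_weight c k n))"
    by (subst (asm) sums_iff_shift) simp
  moreover have "(\<Sum>n<nat k + 1. shell_weight c k n) = real (nat k) + 1"
    by (simp add: shell_weight_def)
  ultimately show ?thesis by (simp only: add_ac)
qed

lemma ex_shell:
  fixes y :: "'a::real_normed_vector"
  shows "\<exists>n. norm y \<le> 2 powr (real n - real_of_int k)
     \<and> (n = 0 \<or> 2 powr (real n - real_of_int k - 1) \<le> norm y)"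
proof -
  define n where "n = (LEAST n. norm y \<le> 2 powr (real n - real_of_int k))"
  obtain m where "norm y * 2 powr real_of_int k < 2 ^ m"
    using real_arch_pow[of 2 "norm y * 2 powr real_of_int k"] by auto
  then have "norm y \<le> 2 powr (real m - real_of_int k)"
    by (simp add: powr_diff powr_realpow field_simps)
  then have n: "norm y \<le> 2 powr (real n - real_of_int k)"
    unfolding n_def by (rule LeastI)
  have lo: "2 powr (real n - real_of_int k - 1) \<le> norm y" if nonzero: "n \<noteq> 0"
  proof -
    obtain m where m: "n = Suc m" using nonzero by (cases n) auto
    then have "\<not> norm y \<le> 2 powr (real m - real_of_int k)"
      by (intro not_less_Least[of m "\<lambda>n. norm y \<le> 2 powr (real n - real_of_int k)", folded n_def]) simp
    moreover have "real n - real_of_int k - 1 = real m - real_of_int k" by (simp add: m)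
    ultimately show ?thesis by (simp only: not_le less_imp_le)
  qed
  have "n = 0 \<or> 2 powr (real n - real_of_int k - 1) \<le> norm y" using lo by blast
  with n show ?thesis by (intro exI[of _ n] conjI)
qed

text \<open>Outside the unit ball the inner radius of the shell is at least
  \<open>2 ^ i \<ge> i\<close> with \<open>i = n - nat k - 1\<close>; keeping only \<open>i\<close>
  turns the exponential decay into a geometric sequence in \<open>n\<close>.\<close>

lemma exp_shell_le:
  assumes "c > 0" "n = 0 \<or> 2 powr (real n - real_of_int k - 1) \<le> s" "s \<ge> 0"
  shows "exp (- c * s) \<le> shell_weight c k n"
proof (cases "n \<le> nat k")
  case True
  with assms show ?thesis by (simp add: shell_weight_def)
next
  case False
  define i where "i = n - nat k - 1"
  have "real i \<le> 2 ^ i" by (simp add: less_imp_le of_nat_less_two_power)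
  also have "\<dots> = 2 powr real i" by (simp add: powr_realpow)
  also have "\<dots> \<le> 2 powr (real n - real_of_int k - 1)"
    using False by (intro powr_mono) (auto simp: i_def of_nat_diff)
  also have "\<dots> \<le> s" using assms(2) False by auto
  finally have "exp (- c * s) \<le> exp (- c * real i)" using assms(1) by simp
  also have "\<dots> = exp (- c) ^ i" by (simp add: exp_of_nat_mult[symmetric] mult.commute)
  finally show ?thesis using False by (simp add: shell_weight_def i_def)
qed

text \<open>The two bounds on \<open>a\<close> serve different regions: \<open>Hi\<close> handles
  the innermost ball, while on the other shells the lower bound on \<open>norm y\<close> converts
  \<open>Hs\<close> into a gain of the reciprocal square root of the radius.\<close>

lemma shell_pointwise:
  fixes y :: "real^3" and a :: complex
  assumes "c > 0" "A > 0" and M: "\<bar>M\<bar> \<le> A * exp (- c * norm y)"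
    and Hi: "ennreal (norm a) \<le> Hi" and Hs: "ennreal (norm (complex_of_real (sqrt (norm y)) * a)) \<le> Hs"
    and lo: "n = 0 \<or> 2 powr (real n - real_of_int k - 1) \<le> norm y"
  shows "ennreal (\<bar>M\<bar> * norm a)
    \<le> (ennreal (2 powr (- real_of_int k / 2)) * Hi + Hs)
       * ennreal (A * sqrt 2 * 2 powr (- (real n - real_of_int k) / 2) * shell_weight c k n)"
proof -
  define H where "H = ennreal (2 powr (- real_of_int k / 2)) * Hi + Hs"
  \<comment> \<open>For \<open>n > 0\<close>, \<open>q\<close> is the reciprocal square root of the
    inner radius \<open>2 powr (n - k - 1)\<close>, the factor \<open>sqrt 2\<close> passing from
    outer to inner radius. For \<open>n = 0\<close> it is at least \<open>2 powr (k / 2)\<close>,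
    which cancels the factor on \<open>Hi\<close>.\<close>
  define q where "q = sqrt 2 * 2 powr (- (real n - real_of_int k) / 2)"
  have q: "q > 0" by (simp add: q_def)
  have "ennreal (norm a) \<le> H * ennreal q"
  proof (cases "n = 0")
    case True
    have "2 powr (- real_of_int k / 2) * norm a * 2 powr (real_of_int k / 2) = norm a"
      by (simp add: powr_minus)
    then have "ennreal (norm a) = ennreal (2 powr (- real_of_int k / 2)) * ennreal (norm a) * ennreal (2 powr (real_of_int k / 2))"
      by (simp flip: ennreal_mult)
    also have "\<dots> \<le> H * ennreal q"
      unfolding H_def using True Hi
      by (intro mult_mono add_increasing2 mult_left_mono ennreal_leI) (auto simp: q_def)
    finally show ?thesis .
  next
    case False
    then have lo': "2 powr (real n - real_of_int k - 1) \<le> norm y" using lo by simp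
    have "1 = q * sqrt (2 powr (real n - real_of_int k - 1))"
    proof -
      have "sqrt 2 = 2 powr (1/2)" by (simp add: powr_half_sqrt)
      moreover have "sqrt (2 powr e) = 2 powr (e / 2)" for e :: real
        by (simp add: powr_half_sqrt[symmetric] powr_powr)
      moreover have "1/2 + (- (real n - real_of_int k) / 2) + (real n - real_of_int k - 1) / 2 = 0"
        by (simp add: field_simps)
      ultimately show ?thesis by (simp only: q_def powr_add[symmetric]) simp
    qed
    also have "\<dots> \<le> q * sqrt (norm y)" using q lo' by (intro mult_left_mono) auto
    finally have "norm a \<le> (sqrt (norm y) * norm a) * q"
      using mult_right_mono[of 1 "q * sqrt (norm y)" "norm a"] by (simp add: mult_ac)
    then have "ennreal (norm a) \<le> ennreal (norm (complex_of_real (sqrt (norm y)) * a)) * ennreal q"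
      using q by (simp add: norm_mult ennreal_leI flip: ennreal_mult)
    also have "\<dots> \<le> H * ennreal q"
      unfolding H_def using Hs by (intro mult_right_mono add_increasing) auto
    finally show ?thesis .
  qed
  moreover have "\<bar>M\<bar> \<le> A * shell_weight c k n"
    by (rule order_trans[OF M mult_left_mono[OF exp_shell_le[OF \<open>c > 0\<close> lo norm_ge_zero] less_imp_le[OF \<open>A > 0\<close>]]])
  ultimately have "ennreal \<bar>M\<bar> * ennreal (norm a) \<le> ennreal (A * shell_weight c k n) * (H * ennreal q)"
    by (intro mult_mono ennreal_leI) auto
  also have "\<dots> = H * ennreal (A * sqrt 2 * 2 powr (- (real n - real_of_int k) / 2) * shell_weight c k n)"
    using \<open>A > 0\<close> q shell_weight_nonneg[of c k n]
    by (simp add: q_def mult_ac flip: ennreal_mult)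
  finally show ?thesis by (simp add: H_def ennreal_mult)
qed

text \<open>The gain from \<open>h\<close> cancels the radius lost by Cauchy-Schwarz, leaving a
  bound uniform in \<open>n\<close>. With outer radius \<open>q\<close>, the point is
  \<open>sqrt (1 + s / q) \<le> 1 + sqrt (s / q)\<close> and \<open>1 / q \<le> 2 powr k\<close>;
  this dictates the weight used for the kernels.\<close>

lemma shell_radius_sqrt:
  "2 powr (- (real n - real_of_int k) / 2) * sqrt (2 * (2 powr (real n - real_of_int k) + s))
    \<le> sqrt 2 * (1 + sqrt (2 powr real_of_int k * s))" if "s \<ge> 0"
proof -
  define q where "q = 2 powr (real n - real_of_int k)"
  have q: "q > 0" by (simp add: q_def)
  have "2 powr (- (real n - real_of_int k) / 2) = sqrt (inverse q)"
    unfolding q_def powr_minus[symmetric]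
    by (simp only: powr_half_sqrt[symmetric] powr_ge_zero powr_powr) simp
  then have "2 powr (- (real n - real_of_int k) / 2) * sqrt (2 * (q + s)) = sqrt (2 * (1 + s / q))"
    using q by (simp add: field_simps flip: real_sqrt_mult)
  also have "\<dots> = sqrt 2 * sqrt (1 + s / q)" by (rule real_sqrt_mult)
  also have "\<dots> \<le> sqrt 2 * (1 + sqrt (2 powr real_of_int k * s))"
  proof (rule mult_left_mono)
    have "inverse q \<le> 2 powr real_of_int k"
      unfolding q_def powr_minus[symmetric] by (intro powr_mono) auto
    then have "s / q \<le> 2 powr real_of_int k * s"
      using that by (simp add: divide_inverse mult_left_mono mult.commute)
    moreover have "sqrt (1 + s / q) \<le> 1 + sqrt (s / q)"
      using q that sqrt_add_le_add_sqrt[of 1 "s / q"] by simp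
    ultimately show "sqrt (1 + s / q) \<le> 1 + sqrt (2 powr real_of_int k * s)"
      using real_sqrt_le_mono[of "s / q" "2 powr real_of_int k * s"] by linarith
  qed simp
  finally show ?thesis by (simp add: q_def)
qed

text \<open>Every shell contributes the same amount times its \<open>shell_weight\<close>, by
  \<open>shell_pointwise\<close>, \<open>shell_estimate\<close> and
  \<open>shell_radius_sqrt\<close>; summing the weights finishes the bound.\<close>

lemma translated_product_estimate:
  fixes f g h :: "real \<times> (real^3) \<Rightarrow> complex"
  assumes "c > 0" "A > 0" and [measurable]: "J \<in> sets borel" "f \<in> borel_measurable borel"
    "g \<in> borel_measurable borel"
    and M: "\<And>x. \<bar>M x\<bar> \<le> A * exp (- c * norm x)"
  shows "(\<integral>\<^sup>+p. ennreal (norm (complex_of_real (M (snd p)) * g p * h p)) *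
       (ennreal (norm (f (p + (0, z)))) * indicator J (fst p)) \<partial>lborel)
    \<le> (ennreal (2 powr (- real_of_int k / 2)) * Linfnorm J (\<lambda>t x. h (t, x))
         + Linfnorm J (\<lambda>t x. complex_of_real (sqrt (norm x)) * h (t, x)))
       * (L2norm_on J UNIV (\<lambda>t x. g (t, x)) * linfL2norm k J (\<lambda>t x. f (t, x))
       * ennreal (2 * A * (real (nat k) + 1 + 1 / (1 - exp (- c))) * (1 + sqrt (2 powr real_of_int k * norm z))))"
proof -
  define Hi where "Hi = Linfnorm J (\<lambda>t x. h (t, x))"
  define Hs where "Hs = Linfnorm J (\<lambda>t x. complex_of_real (sqrt (norm x)) * h (t, x))"
  define H where "H = ennreal (2 powr (- real_of_int k / 2)) * Hi + Hs"
  define G where "G = L2norm_on J UNIV (\<lambda>t x. g (t, x))"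
  define X where "X = linfL2norm k J (\<lambda>t x. f (t, x))"
  define S where "S = real (nat k) + 1 + 1 / (1 - exp (- c))"
  define R where "R n = 2 powr (real n - real_of_int k)" for n
  define a where "a n = A * sqrt 2 * 2 powr (- (real n - real_of_int k) / 2) * shell_weight c k n" for n
  \<comment> \<open>The idempotent indicator of \<open>J\<close> is written twice so that both
    Cauchy-Schwarz factors stay restricted to \<open>J\<close>; the shift leaves time fixed.\<close>
  define u where "u n p = (ennreal (norm (g p)) * indicator J (fst p)) *
       (ennreal (norm (f (p + (0, z)))) * indicator J (fst p) * indicator (cball 0 (R n)) (snd p))" for n p
  have a_nn: "a n \<ge> 0" for n using \<open>A > 0\<close> by (simp add: a_def shell_weight_nonneg)
  have u_meas [measurable]: "u n \<in> borel_measurable borel" for n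
    unfolding u_def
    by (intro borel_measurable_times_ennreal) (simp_all add: measurable_indicator_fst measurable_indicator_snd)
  have "AE p in lborel. ennreal (norm (h p)) * indicator J (fst p) \<le> Hi"
    using esssup_AE[of "\<lambda>p. ennreal (norm (h p)) * indicator J (fst p)" lborel] by (simp add: Hi_def Linfnorm_def)
  moreover have "AE p in lborel. ennreal (norm (complex_of_real (sqrt (norm (snd p))) * h p)) * indicator J (fst p) \<le> Hs"
    using esssup_AE[of "\<lambda>p. ennreal (norm (complex_of_real (sqrt (norm (snd p))) * h p)) * indicator J (fst p)" lborel]
    by (simp add: Hs_def Linfnorm_def)
  \<comment> \<open>The essential suprema bound \<open>h\<close> almost everywhere. At such a point
    one shell containing \<open>snd p\<close> is chosen, and its term is dominated by the full
    sum.\<close>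
  ultimately have "AE p in lborel. ennreal (norm (complex_of_real (M (snd p)) * g p * h p)) *
       (ennreal (norm (f (p + (0, z)))) * indicator J (fst p)) \<le> (\<Sum>n. H * ennreal (a n) * u n p)"
  proof eventually_elim
    case (elim p)
    show ?case
    proof (cases "fst p \<in> J")
      case True
      obtain n where n: "norm (snd p) \<le> R n"
        "n = 0 \<or> 2 powr (real n - real_of_int k - 1) \<le> norm (snd p)"
        using ex_shell[of "snd p" k] unfolding R_def by blast
      have "ennreal (\<bar>M (snd p)\<bar> * norm (h p)) \<le> H * ennreal (a n)"
        unfolding H_def a_def
        by (rule shell_pointwise[OF \<open>c > 0\<close> \<open>A > 0\<close> M _ _ n(2)]) (use elim True in simp_all)
      then have "ennreal (\<bar>M (snd p)\<bar> * norm (h p)) * (ennreal (norm (g p)) * ennreal (norm (f (p + (0, z)))))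
         \<le> H * ennreal (a n) * (ennreal (norm (g p)) * ennreal (norm (f (p + (0, z)))))"
        by (rule mult_right_mono) simp
      moreover have "u n p = ennreal (norm (g p)) * ennreal (norm (f (p + (0, z))))"
        using n(1) True by (simp add: u_def)
      moreover have "ennreal (norm (complex_of_real (M (snd p)) * g p * h p)) * (ennreal (norm (f (p + (0, z)))) * indicator J (fst p))
         = ennreal (\<bar>M (snd p)\<bar> * norm (h p)) * (ennreal (norm (g p)) * ennreal (norm (f (p + (0, z)))))"
        using True by (simp add: norm_mult mult_ac ennreal_mult)
      ultimately have "ennreal (norm (complex_of_real (M (snd p)) * g p * h p)) * (ennreal (norm (f (p + (0, z)))) * indicator J (fst p))
         \<le> H * ennreal (a n) * u n p" by (simp only:)
      also have "\<dots> \<le> (\<Sum>n. H * ennreal (a n) * u n p)" by (rule ennreal_le_suminf)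
      finally show ?thesis .
    qed simp
  qed
  then have "(\<integral>\<^sup>+p. ennreal (norm (complex_of_real (M (snd p)) * g p * h p)) *
       (ennreal (norm (f (p + (0, z)))) * indicator J (fst p)) \<partial>lborel)
     \<le> (\<integral>\<^sup>+p. (\<Sum>n. H * ennreal (a n) * u n p) \<partial>lborel)"
    by (rule nn_integral_mono_AE)
  also have "\<dots> = (\<Sum>n. \<integral>\<^sup>+p. H * ennreal (a n) * u n p \<partial>lborel)"
    by (rule nn_integral_suminf) simp
  also have "\<dots> = (\<Sum>n. H * ennreal (a n) * (\<integral>\<^sup>+p. u n p \<partial>lborel))"
    by (simp add: nn_integral_cmult)
  also have "\<dots> \<le> (\<Sum>n. (H * (G * X * ennreal (2 * A * (1 + sqrt (2 powr real_of_int k * norm z))))) * ennreal (shell_weight c k n))"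
  proof (intro suminf_le summableI)
    fix n
    have "(\<integral>\<^sup>+p. u n p \<partial>lborel) \<le> G * (ennreal (sqrt (2 * (R n + norm z))) * X)"
      unfolding u_def G_def X_def by (rule shell_estimate) (simp_all add: R_def)
    then have "H * ennreal (a n) * (\<integral>\<^sup>+p. u n p \<partial>lborel)
        \<le> H * ennreal (a n) * (G * (ennreal (sqrt (2 * (R n + norm z))) * X))"
      by (rule mult_left_mono) simp
    also have "\<dots> = H * (G * X) * ennreal (a n * sqrt (2 * (R n + norm z)))"
      using a_nn by (simp add: ennreal_mult R_def mult_ac)
    \<comment> \<open>The constant 2 is the product of the \<open>sqrt 2\<close> in
      \<open>a n\<close> and the one from \<open>shell_radius_sqrt\<close>.\<close>
    also have "\<dots> \<le> H * (G * X) * ennreal (2 * A * (1 + sqrt (2 powr real_of_int k * norm z)) * shell_weight c k n)"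
    proof (intro mult_left_mono ennreal_leI)
      define w where "w = 1 + sqrt (2 powr real_of_int k * norm z)"
      have "A * sqrt 2 * shell_weight c k n * (2 powr (- (real n - real_of_int k) / 2) * sqrt (2 * (2 powr (real n - real_of_int k) + norm z)))
         \<le> A * sqrt 2 * shell_weight c k n * (sqrt 2 * w)"
        unfolding w_def using \<open>A > 0\<close> by (intro mult_left_mono shell_radius_sqrt) (simp_all add: shell_weight_nonneg)
      moreover have "A * sqrt 2 * shell_weight c k n * (sqrt 2 * w) = 2 * A * w * shell_weight c k n"
        by simp
      ultimately show "a n * sqrt (2 * (R n + norm z)) \<le> 2 * A * (1 + sqrt (2 powr real_of_int k * norm z)) * shell_weight c k n"
        unfolding w_def[symmetric] by (simp only: a_def R_def mult_ac)
    qed auto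
    also have "\<dots> = (H * (G * X * ennreal (2 * A * (1 + sqrt (2 powr real_of_int k * norm z))))) * ennreal (shell_weight c k n)"
      using \<open>A > 0\<close> by (simp add: ennreal_mult shell_weight_nonneg mult.assoc del: ennreal_plus)
    finally show "H * ennreal (a n) * (\<integral>\<^sup>+p. u n p \<partial>lborel)
       \<le> (H * (G * X * ennreal (2 * A * (1 + sqrt (2 powr real_of_int k * norm z))))) * ennreal (shell_weight c k n)" .
  qed
  also have "\<dots> = (H * (G * X * ennreal (2 * A * (1 + sqrt (2 powr real_of_int k * norm z))))) * ennreal S"
  proof -
    have "(\<Sum>n. ennreal (shell_weight c k n)) = ennreal S"
      using suminf_ennreal_eq[OF shell_weight_nonneg sums_shell_weight[OF \<open>c > 0\<close>]] by (simp add: S_def)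
    then show ?thesis by simp
  qed
  also have "\<dots> = H * (G * X * ennreal (2 * A * S * (1 + sqrt (2 powr real_of_int k * norm z))))"
  proof -
    have "S \<ge> 0" using \<open>c > 0\<close> by (simp add: S_def)
    then have "ennreal (2 * A * S * (1 + sqrt (2 powr real_of_int k * norm z)))
        = ennreal (2 * A * (1 + sqrt (2 powr real_of_int k * norm z))) * ennreal S"
      using \<open>A > 0\<close> by (simp add: mult_ac del: ennreal_plus flip: ennreal_mult)
    then show ?thesis by (simp only: mult.assoc)
  qed
  finally show ?thesis by (simp only: H_def G_def X_def S_def Hi_def Hs_def)
qed

section \<open>Integration over the shifts and choice of the constant\<close>

theorem theorem5p2:
  fixes \<psi> :: "real^3 \<Rightarrow> real" and \<epsilon> c A :: real
  assumes "lp_bump \<psi>" and "0 < \<epsilon>" and "\<epsilon> < 1/2" and "0 < c" and "0 < A"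
  shows "\<exists>C::real. 0 < C \<and>
    (\<forall>(k0::int) (J::real set) (M::real^3 \<Rightarrow> real) (f::real \<Rightarrow> real^3 \<Rightarrow> complex)
       (g::real \<Rightarrow> real^3 \<Rightarrow> complex) (h::real \<Rightarrow> real^3 \<Rightarrow> complex).
       k0 \<noteq> 0 \<longrightarrow> is_interval J \<longrightarrow>
       M \<in> borel_measurable borel \<longrightarrow>
       (\<lambda>p. f (fst p) (snd p)) \<in> borel_measurable borel \<longrightarrow>
       (\<lambda>p. g (fst p) (snd p)) \<in> borel_measurable borel \<longrightarrow>
       (\<lambda>p. h (fst p) (snd p)) \<in> borel_measurable borel \<longrightarrow>
       (\<forall>x. \<bar>M x\<bar> \<le> A * exp (- c * norm x)) \<longrightarrow>
       L1norm J (\<lambda>t x. Iop \<psi> \<epsilon> k0 (\<lambda>y. complex_of_real (M y) * g t y * h t y) x * f t x)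
         \<le> ennreal (C * real_of_int \<bar>k0\<bar>) * L2norm_on J UNIV g
             * linfL2norm k0 J f
             * (ennreal (2 powr (- real_of_int k0 / 2)) * Linfnorm J h
                + Linfnorm J (\<lambda>t x. complex_of_real (sqrt (norm x)) * h t x)))"
proof -
  obtain W :: real where W: "W > 0"
    "\<And>k. (\<integral>\<^sup>+z. Iop_majorant \<psi> \<epsilon> k z * ennreal (1 + sqrt (2 powr real_of_int k * norm z)) \<partial>lborel) \<le> ennreal W"
    using Iop_majorant_weight_bounded[OF assms(1) assms(3)] by blast
  \<comment> \<open>A nonzero integer has \<open>|k| \<ge> 1\<close>, so
    \<open>nat k + 1 + 1 / (1 - exp (- c)) \<le> D * |k|\<close>; the 2 absorbs
    \<open>nat k + 1\<close>.\<close>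
  define D where "D = 2 + 1 / (1 - exp (- c))"
  have D: "D > 0" using \<open>0 < c\<close> by (simp add: D_def add_pos_pos)
  \<comment> \<open>The factor \<open>2 * A\<close> comes from the fixed-shift estimate,
    \<open>D\<close> from counting shells, and \<open>W\<close> from the weighted integral of the
    kernel majorant.\<close>
  define C where "C = 2 * A * D * W"
  have "L1norm J (\<lambda>t x. Iop \<psi> \<epsilon> k (\<lambda>y. complex_of_real (M y) * g t y * h t y) x * f t x)
         \<le> ennreal (C * real_of_int \<bar>k\<bar>) * L2norm_on J UNIV g * linfL2norm k J f
             * (ennreal (2 powr (- real_of_int k / 2)) * Linfnorm J h
                + Linfnorm J (\<lambda>t x. complex_of_real (sqrt (norm x)) * h t x))"
    if k: "k \<noteq> 0" and J: "is_interval J" and M [measurable]: "M \<in> borel_measurable borel"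
      and f: "(\<lambda>p. f (fst p) (snd p)) \<in> borel_measurable borel"
      and g: "(\<lambda>p. g (fst p) (snd p)) \<in> borel_measurable borel"
      and h: "(\<lambda>p. h (fst p) (snd p)) \<in> borel_measurable borel"
      and Mb: "\<forall>x. \<bar>M x\<bar> \<le> A * exp (- c * norm x)"
    for k J M and f g h :: "real \<Rightarrow> real^3 \<Rightarrow> complex"
  proof -
    have Jm: "J \<in> sets borel" by (rule real_interval_borel_measurable[OF J])
    define H where "H = ennreal (2 powr (- real_of_int k / 2)) * Linfnorm J h
                + Linfnorm J (\<lambda>t x. complex_of_real (sqrt (norm x)) * h t x)"
    define Q where "Q = H * (L2norm_on J UNIV g * linfL2norm k J f)"
    define K where "K = Iop_majorant \<psi> \<epsilon> k"
    have K [measurable]: "K \<in> borel_measurable borel"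
      unfolding K_def by (rule measurable_Iop_majorant[OF assms(1)])
    define F where "F p = complex_of_real (M (snd p)) * g (fst p) (snd p) * h (fst p) (snd p)" for p
    have "(\<lambda>p::real \<times> (real^3). complex_of_real (M (snd p))) \<in> borel_measurable borel"
      by (rule measurable_compose[OF borel_measurable_continuous_onI[OF continuous_on_snd[OF continuous_on_id]]]) measurable
    then have Fm: "F \<in> borel_measurable borel"
      unfolding F_def[abs_def] by (intro borel_measurable_times g h)
    define v where "v p = ennreal (norm (f (fst p) (snd p))) * indicator J (fst p)" for p
    have vm: "v \<in> borel_measurable borel"
      unfolding v_def[abs_def] using f
      by (intro borel_measurable_times_ennreal measurable_indicator_fst[OF Jm]) simp
    \<comment> \<open>\<open>Iop\<close> acts in space alone, so the kernel bound is applied to each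
      time slice of \<open>F\<close>.\<close>
    have Ft: "(\<lambda>y. F (t, y)) \<in> borel_measurable borel" for t
      by (rule measurable_compose[OF borel_measurable_continuous_onI Fm]) (intro continuous_intros)
    have "L1norm J (\<lambda>t x. Iop \<psi> \<epsilon> k (\<lambda>y. complex_of_real (M y) * g t y * h t y) x * f t x)
       = (\<integral>\<^sup>+p. ennreal (norm (Iop \<psi> \<epsilon> k (\<lambda>y. F (fst p, y)) (snd p))) * v p \<partial>lborel)"
      unfolding L1norm_def by (simp add: F_def v_def norm_mult ennreal_mult mult.assoc)
    also have "\<dots> \<le> (\<integral>\<^sup>+p. abs_conv K (\<lambda>y. F (fst p, y)) (snd p) * v p \<partial>lborel)"
      unfolding K_def by (intro nn_integral_mono mult_right_mono norm_Iop_le[OF assms(1) Ft]) simp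
    also have "\<dots> = (\<integral>\<^sup>+z. K z * (\<integral>\<^sup>+p. ennreal (norm (F p)) * v (p + (0, z)) \<partial>lborel) \<partial>lborel)"
      by (rule nn_integral_abs_conv[OF K Fm vm])
    also have "\<dots> \<le> (\<integral>\<^sup>+z. K z * (Q * ennreal (2 * A * (D * \<bar>real_of_int k\<bar>) * (1 + sqrt (2 powr real_of_int k * norm z)))) \<partial>lborel)"
    proof (intro nn_integral_mono mult_left_mono)
      fix z :: "real^3"
      have "(\<integral>\<^sup>+p. ennreal (norm (F p)) * v (p + (0, z)) \<partial>lborel)
         \<le> H * (L2norm_on J UNIV g * linfL2norm k J f
          * ennreal (2 * A * (real (nat k) + 1 + 1 / (1 - exp (- c))) * (1 + sqrt (2 powr real_of_int k * norm z))))"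
        using translated_product_estimate[of c A J "\<lambda>p. f (fst p) (snd p)" "\<lambda>p. g (fst p) (snd p)" M
            "\<lambda>p. h (fst p) (snd p)" z k] \<open>0 < c\<close> \<open>0 < A\<close> Jm f g Mb
        by (simp add: F_def v_def H_def del: ennreal_plus)
      also have "\<dots> \<le> H * (L2norm_on J UNIV g * linfL2norm k J f
          * ennreal (2 * A * (D * \<bar>real_of_int k\<bar>) * (1 + sqrt (2 powr real_of_int k * norm z))))"
      proof (intro mult_left_mono ennreal_leI mult_right_mono)
        have e: "1 / (1 - exp (- c)) > 0" using \<open>0 < c\<close> by simp
        have "1 \<le> \<bar>real_of_int k\<bar>" "real (nat k) \<le> \<bar>real_of_int k\<bar>" using k by linarith+
        moreover from this e have "1 / (1 - exp (- c)) * 1 \<le> 1 / (1 - exp (- c)) * \<bar>real_of_int k\<bar>"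
          by (intro mult_left_mono) auto
        ultimately show "real (nat k) + 1 + 1 / (1 - exp (- c)) \<le> D * \<bar>real_of_int k\<bar>"
          unfolding D_def distrib_right by linarith
      qed (use \<open>0 < A\<close> in auto)
      finally show "(\<integral>\<^sup>+p. ennreal (norm (F p)) * v (p + (0, z)) \<partial>lborel)
         \<le> Q * ennreal (2 * A * (D * \<bar>real_of_int k\<bar>) * (1 + sqrt (2 powr real_of_int k * norm z)))"
        by (simp only: Q_def mult.assoc)
    qed simp
    \<comment> \<open>The only dependence on \<open>z\<close> left is the weight whose integral
      against \<open>K\<close> is bounded by \<open>W\<close>, uniformly in
      \<open>k\<close>.\<close>
    also have "\<dots> = Q * ennreal (2 * A * (D * \<bar>real_of_int k\<bar>)) *
        (\<integral>\<^sup>+z. K z * ennreal (1 + sqrt (2 powr real_of_int k * norm z)) \<partial>lborel)"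
    proof -
      have "K z * (Q * ennreal (2 * A * (D * \<bar>real_of_int k\<bar>) * (1 + sqrt (2 powr real_of_int k * norm z))))
        = Q * ennreal (2 * A * (D * \<bar>real_of_int k\<bar>)) * (K z * ennreal (1 + sqrt (2 powr real_of_int k * norm z)))" for z
      proof -
        have "ennreal (2 * A * (D * \<bar>real_of_int k\<bar>) * (1 + sqrt (2 powr real_of_int k * norm z)))
          = ennreal (2 * A * (D * \<bar>real_of_int k\<bar>)) * ennreal (1 + sqrt (2 powr real_of_int k * norm z))"
          using \<open>0 < A\<close> D by (intro ennreal_mult) auto
        then show ?thesis by (simp only: mult_ac)
      qed
      then show ?thesis by (simp add: nn_integral_cmult del: ennreal_plus)
    qed
    also have "\<dots> \<le> Q * ennreal (2 * A * (D * \<bar>real_of_int k\<bar>)) * ennreal W"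
      unfolding K_def by (intro mult_left_mono W) simp
    also have "\<dots> = Q * ennreal (C * real_of_int \<bar>k\<bar>)"
    proof -
      have "ennreal (2 * A * (D * \<bar>real_of_int k\<bar>)) * ennreal W = ennreal (C * real_of_int \<bar>k\<bar>)"
        using \<open>0 < A\<close> D W(1) by (simp add: C_def mult_ac flip: ennreal_mult)
      then show ?thesis by (simp only: mult.assoc)
    qed
    finally show ?thesis by (simp add: Q_def H_def mult_ac)
  qed
  moreover have "C > 0" using \<open>0 < A\<close> D W(1) by (simp add: C_def)
  ultimately show ?thesis by (intro exI[of _ C]) blast
qed

end
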